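(* Let $G$ be a finite connected simple undirected graph with at least one edge and maximum degree $\Delta$. Then for every vertex $v_i$ of $G$, with degree $d_i$, $$\mathcal{E}_G(v_i)\ge \frac{d_i}{\Delta}.$$ Equality holds if and only if $G$ is isomorphic to the complete bipartite graph $K_{d,d}$ for some $d\ge1$.
   Context: For a finite simple undirected graph $G$ with vertices $v_1,\dots,v_n$ and adjacency matrix $A$, let $|A|=(AA^* )^{1/2}$. The energy of the vertex $v_i$ is $\mathcal{E}_G(v_i)=|A|_{ii}$. $d_i$ denotes the degree of $v_i$ and $\Delta$ the maximum degree of $G$. *)

theory Defs
  imports
    "Graph_Theory.Graph_Theory"
    "Jordan_Normal_Form.Schur_Decomposition"
begin

text \<open>
  A finite simple undirected graph is a \<open>pair_graph\<close>: a finite, loop-free digraph without parallel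
  arcs whose arc set is symmetric. An undirected edge is the pair of its two arcs, so the degree of
  a vertex is its \<open>out_degree\<close>, and \<open>connected\<close> is connectedness in the usual sense.
\<close>

definition max_degree :: "('a, 'b) pre_digraph \<Rightarrow> nat" where
  "max_degree G = Max (out_degree G ` verts G)"

text \<open>The vertices are enumerated as \<open>v\<^sub>1, \<dots>, v\<^sub>n\<close> by a list, indexed from 0.\<close>

definition adj_mat :: "'a pair_pre_digraph \<Rightarrow> 'a list \<Rightarrow> real mat" where
  "adj_mat G vs = mat (length vs) (length vs) (\<lambda>(i, j). if (vs ! i, vs ! j) \<in> parcs G then 1 else 0)"

text \<open>Symmetry has to be required: over the reals it does not follow from the inequality.\<close>

definition psd_mat :: "real mat \<Rightarrow> bool" where
  "psd_mat B \<longleftrightarrow> square_mat B \<and> mat_adjoint B = B \<and>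
     (\<forall>x \<in> carrier_vec (dim_row B). x \<bullet> (B *\<^sub>v x) \<ge> 0)"

text \<open>
  The square root of a positive semidefinite matrix \<open>M\<close> is its unique positive semidefinite square
  root; \<open>psd_sqrt M\<close> is unspecified for other \<open>M\<close>.
\<close>

definition psd_sqrt :: "real mat \<Rightarrow> real mat" where
  "psd_sqrt M = (THE B. B \<in> carrier_mat (dim_row M) (dim_row M) \<and> psd_mat B \<and> B * B = M)"

definition mat_abs :: "real mat \<Rightarrow> real mat" where
  "mat_abs A = psd_sqrt (A * mat_adjoint A)"

definition vertex_energy :: "'a pair_pre_digraph \<Rightarrow> 'a list \<Rightarrow> nat \<Rightarrow> real" where
  "vertex_energy G vs i = mat_abs (adj_mat G vs) $$ (i, i)"

definition complete_bipartite :: "nat \<Rightarrow> nat \<Rightarrow> (nat + nat) pair_pre_digraph" where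
  "complete_bipartite m n = (let U = Inl ` {..<m}; V = Inr ` {..<n}
     in \<lparr> pverts = U \<union> V, parcs = U \<times> V \<union> V \<times> U \<rparr>)"

lemma complete_bipartite_digraph_complete_bipartite:
  "complete_bipartite_digraph m n (with_proj (complete_bipartite m n))"
proof -
  have "card (Inl ` {..<m} :: (nat + nat) set) = m" "card (Inr ` {..<n} :: (nat + nat) set) = n"
    by (simp_all add: card_image)
  moreover have "Inl ` {..<m} \<inter> Inr ` {..<n} = {}"
    by auto
  ultimately show ?thesis
    unfolding complete_bipartite_digraph_pair_def complete_bipartite_def Let_def
    by (metis finite_Un finite_imageI finite_lessThan pair_pre_digraph.select_convs)
qed

end

theory Submission
  imports Defs "HOL-Computational_Algebra.Formal_Power_Series"
begin

text \<open>
  Let \<open>B = |A|\<close>, so \<open>B\<^sup>2 = A\<^sup>2\<close>, and let \<open>e\<close> be the unit vector of the vertex \<open>v\<close>. Since all row sums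
  of \<open>A\<close> are at most \<open>\<Delta>\<close>, \<open>\<parallel>B\<parallel> \<le> \<Delta>\<close>, hence \<open>\<Delta> B - B\<^sup>2\<close> is positive semidefinite, and its diagonal entry at
  \<open>v\<close> is \<open>\<Delta> \<cdot> \<E>(v) - d(v)\<close>. If that entry vanishes, then \<open>(\<Delta> B - B\<^sup>2) e = 0\<close>, which gives
  \<open>A\<^sup>3 e = \<Delta>\<^sup>2 A e\<close>: there are \<open>\<Delta>\<^sup>2\<close> walks of length 3 from any neighbour \<open>w\<close> of \<open>v\<close> to \<open>v\<close>. Such a walk
  is determined by an edge from a neighbour of \<open>w\<close> to a neighbour of \<open>v\<close>, so \<open>v\<close> and \<open>w\<close> have degree \<open>\<Delta>\<close>
  and their neighbourhoods are completely joined. By connectedness \<open>G\<close> is \<open>K\<^bsub>\<Delta>,\<Delta>\<^esub>\<close>.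

  The square root of a positive semidefinite matrix is obtained, after scaling, from the binomial
  series of \<open>sqrt (1 - R)\<close> for a symmetric contraction \<open>R\<close>.
\<close>

section \<open>Positive semidefinite matrices\<close>

lemma mat_adjoint_real:
  fixes A :: "real mat"
  shows "mat_adjoint A = transpose_mat A"
  by (rule eq_matI) (auto simp: mat_adjoint_def mat_of_rows_def)

lemma psd_mat_iff:
  assumes "B \<in> carrier_mat n n"
  shows "psd_mat B \<longleftrightarrow> transpose_mat B = B \<and> (\<forall>x \<in> carrier_vec n. x \<bullet> (B *\<^sub>v x) \<ge> 0)"
  using assms by (auto simp: psd_mat_def mat_adjoint_real square_mat.simps)

lemma scalar_prod_self_eq_0:
  fixes x :: "real vec"
  assumes "x \<in> carrier_vec n"
  shows "x \<bullet> x = 0 \<longleftrightarrow> x = 0\<^sub>v n"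
proof
  assume "x \<bullet> x = 0"
  then have "\<forall>i<n. x $ i = 0"
    using assms by (auto simp: scalar_prod_def sum_nonneg_eq_0_iff)
  then show "x = 0\<^sub>v n"
    using assms by (intro eq_vecI) auto
qed (use assms in auto)

lemma scalar_prod_self_nonneg:
  fixes x :: "real vec"
  shows "0 \<le> x \<bullet> x"
  by (auto simp: scalar_prod_def intro: sum_nonneg)

section \<open>Quadratic forms of symmetric matrices and Cauchy-Schwarz\<close>

lemma sym_mat_scalar_prod:
  fixes B :: "real mat"
  assumes "B \<in> carrier_mat n n" "transpose_mat B = B" "x \<in> carrier_vec n" "y \<in> carrier_vec n"
  shows "(B *\<^sub>v x) \<bullet> y = x \<bullet> (B *\<^sub>v y)"
  using transpose_vec_mult_scalar[of B n n y x] assms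
  by (metis carrier_matD comm_scalar_prod mult_mat_vec_carrier)

lemma mult_add_smult_vec:
  fixes B :: "real mat"
  assumes B: "B \<in> carrier_mat n n" and x: "x \<in> carrier_vec n" and y: "y \<in> carrier_vec n"
  shows "B *\<^sub>v (x + t \<cdot>\<^sub>v y) = B *\<^sub>v x + t \<cdot>\<^sub>v (B *\<^sub>v y)"
  using assms by (simp add: mult_add_distrib_mat_vec[OF B] mult_mat_vec[OF B])

lemma scalar_prod_add_smult:
  fixes x y :: "real vec"
  assumes "x \<in> carrier_vec n" "y \<in> carrier_vec n" "z \<in> carrier_vec n" "w \<in> carrier_vec n"
  shows "(x + t \<cdot>\<^sub>v y) \<bullet> (z + t \<cdot>\<^sub>v w) = x \<bullet> z + t * (x \<bullet> w + y \<bullet> z) + t\<^sup>2 * (y \<bullet> w)"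
  using assms
  by (simp add: add_scalar_prod_distrib[of _ n] scalar_prod_add_distrib[of _ n]
      algebra_simps power2_eq_square)

lemma smult_mat_mult_vec:
  fixes M :: "real mat"
  assumes "M \<in> carrier_mat n m" "x \<in> carrier_vec m"
  shows "(c \<cdot>\<^sub>m M) *\<^sub>v x = c \<cdot>\<^sub>v (M *\<^sub>v x)"
  using assms by (intro eq_vecI) (auto simp: scalar_prod_def sum_distrib_left mult.assoc)

text \<open>The form of \<open>B\<close> at \<open>x + t y\<close> is a quadratic polynomial in
  \<open>t\<close> that is never negative, so its discriminant is not positive. The leading
  coefficient \<open>c\<close> may vanish, since \<open>B\<close> is only semidefinite.\<close>

lemma psd_Cauchy_Schwarz:
  assumes B: "B \<in> carrier_mat n n" and psd: "psd_mat B"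
    and x: "x \<in> carrier_vec n" and y: "y \<in> carrier_vec n"
  shows "(x \<bullet> (B *\<^sub>v y))\<^sup>2 \<le> (x \<bullet> (B *\<^sub>v x)) * (y \<bullet> (B *\<^sub>v y))"
proof -
  define a b c where "a = x \<bullet> (B *\<^sub>v x)" and "b = x \<bullet> (B *\<^sub>v y)" and "c = y \<bullet> (B *\<^sub>v y)"
  have sym: "transpose_mat B = B" and nonneg: "\<And>z. z \<in> carrier_vec n \<Longrightarrow> 0 \<le> z \<bullet> (B *\<^sub>v z)"
    using psd psd_mat_iff[OF B] by auto
  have Bv: "B *\<^sub>v z \<in> carrier_vec n" for z
    using B by (intro carrier_vecI) auto
  have "y \<bullet> (B *\<^sub>v x) = b"
    unfolding b_def using sym_mat_scalar_prod[OF B sym x y] comm_scalar_prod[OF y Bv, of x] by simp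
  then have q: "0 \<le> a + t * (2 * b) + t\<^sup>2 * c" for t
    using nonneg[of "x + t \<cdot>\<^sub>v y"] x y
    by (simp add: mult_add_smult_vec[OF B x y] scalar_prod_add_smult[OF x y Bv Bv] a_def b_def c_def)
  have "b\<^sup>2 \<le> a * c"
  proof (cases "c = 0")
    case True
    have "b = 0"
    proof (rule ccontr)
      assume "b \<noteq> 0"
      with True show False
        \<comment> \<open>The polynomial is now affine in \<open>t\<close>, and this choice gives it
          the value -1.\<close>
        using q[of "- (a + 1) / (2 * b)"] by simp
    qed
    then show ?thesis using True by simp
  next
    case False
    then have "c > 0" using nonneg[OF y] by (simp add: c_def)
    then show ?thesis
      \<comment> \<open>The minimiser of the polynomial, where its value is
        \<open>a - b^2 / c\<close>.\<close>
      using q[of "- b / c"] by (simp add: field_simps power2_eq_square)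
  qed
  then show ?thesis by (simp add: a_def b_def c_def)
qed

text \<open>Cauchy-Schwarz for the pair \<open>B x\<close>, \<open>x\<close> bounds the fourth power
  of the length of \<open>B x\<close> by a product with a zero factor.\<close>

lemma psd_quadratic_form_eq_0:
  assumes B: "B \<in> carrier_mat n n" and psd: "psd_mat B"
    and x: "x \<in> carrier_vec n" and 0: "x \<bullet> (B *\<^sub>v x) = 0"
  shows "B *\<^sub>v x = 0\<^sub>v n"
proof -
  have Bx: "B *\<^sub>v x \<in> carrier_vec n" using B by (intro carrier_vecI) auto
  have "((B *\<^sub>v x) \<bullet> (B *\<^sub>v x))\<^sup>2 \<le> 0"
    using psd_Cauchy_Schwarz[OF B psd Bx x] 0 by simp
  then show ?thesis using scalar_prod_self_eq_0[OF Bx] by simp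
qed

text \<open>Spectrally, every eigenvalue of \<open>B\<close> lies between 0 and \<open>t\<close>, so
  its square is at most \<open>t\<close> times itself. The proof avoids eigenvalues by applying
  Cauchy-Schwarz to \<open>x\<close> and \<open>B x\<close>.\<close>

lemma psd_norm_sq_le:
  assumes B: "B \<in> carrier_mat n n" and psd: "psd_mat B" and t: "t > 0"
    and bound: "\<And>y. y \<in> carrier_vec n \<Longrightarrow> (B *\<^sub>v y) \<bullet> (B *\<^sub>v y) \<le> t\<^sup>2 * (y \<bullet> y)"
    and x: "x \<in> carrier_vec n"
  shows "(B *\<^sub>v x) \<bullet> (B *\<^sub>v x) \<le> t * (x \<bullet> (B *\<^sub>v x))"
proof -
  have Bv: "B *\<^sub>v z \<in> carrier_vec n" for z
    using B by (intro carrier_vecI) auto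
  have sym: "transpose_mat B = B" and nonneg: "\<And>z. z \<in> carrier_vec n \<Longrightarrow> 0 \<le> z \<bullet> (B *\<^sub>v z)"
    using psd psd_mat_iff[OF B] by auto
  have form_le: "y \<bullet> (B *\<^sub>v y) \<le> t * (y \<bullet> y)" if y: "y \<in> carrier_vec n" for y
  proof -
    \<comment> \<open>Expanding the squared length of \<open>B y - t y\<close> and inserting
      \<open>bound\<close> for that of \<open>B y\<close> yields \<open>form_le\<close>.\<close>
    have "0 \<le> (B *\<^sub>v y + (-t) \<cdot>\<^sub>v y) \<bullet> (B *\<^sub>v y + (-t) \<cdot>\<^sub>v y)"
      by (rule scalar_prod_self_nonneg)
    also have "\<dots> = (B *\<^sub>v y) \<bullet> (B *\<^sub>v y) - 2 * t * (y \<bullet> (B *\<^sub>v y)) + t\<^sup>2 * (y \<bullet> y)"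
      using sym_mat_scalar_prod[OF B sym y y]
      by (subst scalar_prod_add_smult[OF Bv y Bv y]) simp
    finally have "t * (y \<bullet> (B *\<^sub>v y)) \<le> t * (t * (y \<bullet> y))"
      using bound[OF y] by (simp add: power2_eq_square)
    then show ?thesis using t by simp
  qed
  define s where "s = (B *\<^sub>v x) \<bullet> (B *\<^sub>v x)"
  have "s \<ge> 0" by (simp add: s_def scalar_prod_self_nonneg)
  \<comment> \<open>Symmetry turns the mixed term of Cauchy-Schwarz into \<open>s\<close>. Then
    \<open>form_le\<close> at \<open>B x\<close> leaves a common factor \<open>s\<close>, which
    cancels unless \<open>s = 0\<close>, where the bound is clear.\<close>
  have "s * s \<le> (x \<bullet> (B *\<^sub>v x)) * ((B *\<^sub>v x) \<bullet> (B *\<^sub>v (B *\<^sub>v x)))"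
    using psd_Cauchy_Schwarz[OF B psd x Bv[of x]] sym_mat_scalar_prod[OF B sym x Bv[of x]]
    by (simp add: s_def power2_eq_square)
  also have "\<dots> \<le> (x \<bullet> (B *\<^sub>v x)) * (t * s)"
    unfolding s_def by (intro mult_left_mono form_le Bv nonneg x)
  finally have "s * s \<le> (t * (x \<bullet> (B *\<^sub>v x))) * s" by (simp add: mult_ac)
  moreover have "s > 0 \<or> s = 0" using \<open>s \<ge> 0\<close> by auto
  ultimately have "s \<le> t * (x \<bullet> (B *\<^sub>v x))"
    using t nonneg[OF x] by auto
  then show ?thesis by (simp add: s_def)
qed

section \<open>Square roots\<close>

lemma gbinomial_Suc_ratio:
  fixes a :: real
  shows "a gchoose Suc k = (a gchoose k) * (a - real k) / real (Suc k)"
  by (simp add: gbinomial_prod_rev field_simps)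

text \<open>The Taylor coefficients of \<open>sqrt (1 - x)\<close> at 0.\<close>

definition sqrt_coeff :: "nat \<Rightarrow> real" where
  "sqrt_coeff k = (-1) ^ k * (1/2 gchoose k)"

lemma sqrt_coeff_0 [simp]: "sqrt_coeff 0 = 1"
  by (simp add: sqrt_coeff_def)

text \<open>The first coefficient after the constant one is -1/2, and from there on consecutive
  coefficients have the nonnegative ratio \<open>(k - 1/2) / (k + 1)\<close>.\<close>

lemma sqrt_coeff_nonpos:
  assumes "k > 0"
  shows "sqrt_coeff k \<le> 0"
  using assms
proof (induction k rule: nat_induct_non_zero)
  case 1
  then show ?case by (simp add: sqrt_coeff_def)
next
  case (Suc k)
  have "sqrt_coeff (Suc k) = sqrt_coeff k * ((real k - 1/2) / real (Suc k))"
    by (simp add: sqrt_coeff_def gbinomial_Suc_ratio field_simps)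
  then show ?case
    using Suc by (simp only:) (intro mult_nonpos_nonneg divide_nonneg_pos; simp)
qed

text \<open>The partial sums of the coefficients of \<open>(1 - x)^(1/2)\<close> are the
  coefficients of \<open>(1 - x)^(-1/2)\<close>, and those are nonnegative by induction on their
  ratio.\<close>

lemma sum_sqrt_coeff_nonneg: "0 \<le> (\<Sum>k\<le>m. sqrt_coeff k)"
proof -
  have "0 \<le> (-1) ^ m * (-1/2 gchoose m :: real)"
  proof (induction m)
    case (Suc m)
    have "(-1) ^ Suc m * (-1/2 gchoose Suc m :: real)
        = ((-1) ^ m * (-1/2 gchoose m)) * ((real m + 1/2) / real (Suc m))"
      by (simp add: gbinomial_Suc_ratio field_simps)
    moreover have "0 \<le> (real m + 1/2) / real (Suc m)"
      by simp
    ultimately show ?case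
      using Suc by (metis mult_nonneg_nonneg)
  qed simp
  then show ?thesis
    using gbinomial_sum_lower_neg[of "1/2::real" m] by (simp add: sqrt_coeff_def mult.commute)
qed

text \<open>Only the constant coefficient is positive, so a partial sum of absolute values is 2
  minus the signed partial sum, hence at most 2.\<close>

lemma summable_abs_sqrt_coeff: "summable (\<lambda>k. \<bar>sqrt_coeff k\<bar>)"
proof (rule summableI_nonneg_bounded)
  fix m
  have "(\<Sum>k<m. \<bar>sqrt_coeff k\<bar>) \<le> (\<Sum>k\<le>m. \<bar>sqrt_coeff k\<bar>)"
    by (intro sum_mono2) auto
  also have "\<dots> = 1 + (\<Sum>k\<in>{..m} - {0}. - sqrt_coeff k)"
    using sqrt_coeff_nonpos by (subst sum.remove[of _ 0]) (auto intro!: sum.cong)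
  also have "\<dots> = 2 - (\<Sum>k\<le>m. sqrt_coeff k)"
    by (subst (2) sum.remove[of _ 0]) (auto simp: sum_negf)
  also have "\<dots> \<le> 2"
    using sum_sqrt_coeff_nonneg[of m] by simp
  finally show "(\<Sum>k<m. \<bar>sqrt_coeff k\<bar>) \<le> 2" .
qed simp

text \<open>The identity \<open>sqrt (1 - x) * sqrt (1 - x) = 1 - x\<close> read off
  coefficientwise; it is Vandermonde's convolution with both upper arguments 1/2.\<close>

lemma sqrt_coeff_convolution:
  "(\<Sum>i\<le>k. sqrt_coeff i * sqrt_coeff (k - i)) = (if k = 0 then 1 else if k = 1 then -1 else 0)"
proof -
  have "(\<Sum>i\<le>k. sqrt_coeff i * sqrt_coeff (k - i))
      = (-1) ^ k * (\<Sum>i=0..k. (1/2 gchoose i) * (1/2 gchoose (k - i)))"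
    unfolding sum_distrib_left atLeast0AtMost
  proof (intro sum.cong refl)
    fix i assume "i \<in> {..k}"
    then have "(-1::real) ^ k = (-1) ^ i * (-1) ^ (k - i)"
      by (simp flip: power_add)
    then show "sqrt_coeff i * sqrt_coeff (k - i)
        = (-1) ^ k * ((1/2 gchoose i) * (1/2 gchoose (k - i)))"
      by (simp add: sqrt_coeff_def)
  qed
  also have "\<dots> = (-1) ^ k * (1 gchoose k)"
    using gbinomial_Vandermonde[of "1/2::real" "1/2" k] by (simp add: atLeast0AtMost)
  also have "\<dots> = (if k = 0 then 1 else if k = 1 then -1 else 0)"
    using binomial_gbinomial[of 1 k, where 'a = real] by (cases k) (auto simp: binomial_eq_0)
  finally show ?thesis .
qed

section \<open>Powers of symmetric contractions and the square root series\<close>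

lemma pow_mat_add:
  assumes A: "A \<in> carrier_mat n n"
  shows "A ^\<^sub>m (j + k) = A ^\<^sub>m j * A ^\<^sub>m k"
proof (induction k)
  case 0
  then show ?case using A by (simp add: right_mult_one_mat[OF pow_carrier_mat[OF A]])
next
  case (Suc k)
  then show ?case
    using A by (simp add: assoc_mult_mat[of _ n n _ n _ n])
qed

lemma sym_pow_mat:
  fixes R :: "real mat"
  assumes R: "R \<in> carrier_mat n n" and sym: "transpose_mat R = R"
  shows "transpose_mat (R ^\<^sub>m k) = R ^\<^sub>m k"
proof (induction k)
  case 0
  then show ?case using R by simp
next
  case (Suc k)
  have "transpose_mat (R ^\<^sub>m Suc k) = R * R ^\<^sub>m k"
    using R Suc sym by (simp add: transpose_mult[of _ n n])
  also have "\<dots> = R ^\<^sub>m Suc k"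
    using pow_mat_add[OF R, of 1 k] R by simp
  finally show ?case .
qed

lemma contraction_pow_mat:
  fixes R :: "real mat"
  assumes R: "R \<in> carrier_mat n n"
    and contr: "\<And>x. x \<in> carrier_vec n \<Longrightarrow> (R *\<^sub>v x) \<bullet> (R *\<^sub>v x) \<le> x \<bullet> x"
    and x: "x \<in> carrier_vec n"
  shows "((R ^\<^sub>m k) *\<^sub>v x) \<bullet> ((R ^\<^sub>m k) *\<^sub>v x) \<le> x \<bullet> x"
  using x
proof (induction k arbitrary: x)
  case 0
  then show ?case using R by simp
next
  case (Suc k)
  have "R ^\<^sub>m Suc k *\<^sub>v x = (R ^\<^sub>m k) *\<^sub>v (R *\<^sub>v x)"
    using R Suc.prems by (simp add: assoc_mult_mat_vec[of _ n n _ n])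
  then show ?case
    using Suc.IH[of "R *\<^sub>v x"] contr[OF Suc.prems] R Suc.prems by simp
qed

text \<open>Both \<open>x + y\<close> and \<open>x - y\<close> have nonnegative squared length. This
  weak Cauchy-Schwarz inequality suffices to bound entries and quadratic forms of powers of a
  contraction.\<close>

lemma two_scalar_prod_le:
  fixes x y :: "real vec"
  assumes x: "x \<in> carrier_vec n" and y: "y \<in> carrier_vec n"
  shows "2 * \<bar>x \<bullet> y\<bar> \<le> x \<bullet> x + y \<bullet> y"
proof -
  have "0 \<le> (x + t \<cdot>\<^sub>v y) \<bullet> (x + t \<cdot>\<^sub>v y)" for t
    by (rule scalar_prod_self_nonneg)
  from this[of 1] this[of "-1"] show ?thesis
    using comm_scalar_prod[OF x y] by (simp only: scalar_prod_add_smult[OF x y x y]) simp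
qed

lemma index_mat_scalar_prod:
  fixes M :: "real mat"
  assumes "M \<in> carrier_mat n n" "i < n" "j < n"
  shows "M $$ (i, j) = unit_vec n i \<bullet> (M *\<^sub>v unit_vec n j)"
  using assms by (simp add: scalar_prod_left_unit[of _ n])

lemma quadratic_form_eq_sum:
  fixes M :: "real mat"
  assumes "M \<in> carrier_mat n n" "x \<in> carrier_vec n"
  shows "x \<bullet> (M *\<^sub>v x) = (\<Sum>i<n. \<Sum>j<n. x $ i * x $ j * M $$ (i, j))"
  using assms
  by (auto simp: scalar_prod_def sum_distrib_left lessThan_atLeast0 mult_ac intro!: sum.cong)

lemma index_mult_mat_sum:
  fixes M N :: "real mat"
  assumes "M \<in> carrier_mat n n" "N \<in> carrier_mat n n" "i < n" "j < n"
  shows "(M * N) $$ (i, j) = (\<Sum>l<n. M $$ (i, l) * N $$ (l, j))"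
  using assms by (auto simp: scalar_prod_def lessThan_atLeast0)

text \<open>The root is the series of \<open>sqrt_coeff k\<close> times the powers of
  \<open>R\<close>, taken entrywise. Entries of the powers are at most 1 in absolute value, so it
  converges absolutely, and its Cauchy square collapses to \<open>1 - R\<close>.\<close>

lemma contraction_sqrt_exists:
  fixes R :: "real mat"
  assumes R: "R \<in> carrier_mat n n" and sym: "transpose_mat R = R"
    and contr: "\<And>x. x \<in> carrier_vec n \<Longrightarrow> (R *\<^sub>v x) \<bullet> (R *\<^sub>v x) \<le> x \<bullet> x"
  shows "\<exists>B \<in> carrier_mat n n. psd_mat B \<and> B * B = 1\<^sub>m n - R"
proof -
  define P where "P k = R ^\<^sub>m k" for k
  have P: "P k \<in> carrier_mat n n" for k
    using R by (simp add: P_def)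
  have Pv: "P k *\<^sub>v x \<in> carrier_vec n" for k x
    using P[of k] by (intro carrier_vecI) auto
  have form_le: "2 * \<bar>x \<bullet> (P k *\<^sub>v y)\<bar> \<le> x \<bullet> x + y \<bullet> y"
    if "x \<in> carrier_vec n" "y \<in> carrier_vec n" for x y k
    using two_scalar_prod_le[OF that(1) Pv[of k y]] contraction_pow_mat[OF R contr that(2), of k]
    by (simp add: P_def)
  have entry_le: "\<bar>P k $$ (i, j)\<bar> \<le> 1" if "i < n" "j < n" for i j k
    using form_le[of "unit_vec n i" "unit_vec n j" k] index_mat_scalar_prod[OF P that] that by simp
  have sm: "summable (\<lambda>k. norm (sqrt_coeff k * P k $$ (i, j)))" if "i < n" "j < n" for i j
  proof (rule summable_norm_comparison_test)
    show "\<exists>N. \<forall>k\<ge>N. norm (sqrt_coeff k * P k $$ (i, j)) \<le> \<bar>sqrt_coeff k\<bar>"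
      using mult_left_mono[OF entry_le[OF that]] by (auto simp: abs_mult)
  qed (rule summable_abs_sqrt_coeff)
  define B where "B = mat n n (\<lambda>(i, j). \<Sum>k. sqrt_coeff k * P k $$ (i, j))"
  have B: "B \<in> carrier_mat n n"
    by (simp add: B_def)
  have B_sums: "(\<lambda>k. sqrt_coeff k * P k $$ (i, j)) sums (B $$ (i, j))" if "i < n" "j < n" for i j
    using summable_sums[OF summable_norm_cancel[OF sm[OF that]]] that by (simp add: B_def)
  have "transpose_mat B = B"
  proof (rule eq_matI)
    fix i j assume "i < dim_row B" "j < dim_col B"
    then have ij: "i < n" "j < n" by (auto simp: B_def)
    have "P k $$ (j, i) = P k $$ (i, j)" for k
      using sym_pow_mat[OF R sym, of k] P[of k] ij by (metis P_def carrier_matD index_transpose_mat(1))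
    then show "transpose_mat B $$ (i, j) = B $$ (i, j)"
      using ij by (simp add: B_def)
  qed (use B in auto)
  moreover have "0 \<le> x \<bullet> (B *\<^sub>v x)" if x: "x \<in> carrier_vec n" for x
  proof -
    have "(\<lambda>k. \<Sum>i<n. \<Sum>j<n. x $ i * x $ j * (sqrt_coeff k * P k $$ (i, j)))
        sums (\<Sum>i<n. \<Sum>j<n. x $ i * x $ j * B $$ (i, j))"
      by (intro sums_sum sums_mult B_sums) auto
    then have "(\<lambda>k. sqrt_coeff k * (x \<bullet> (P k *\<^sub>v x))) sums (x \<bullet> (B *\<^sub>v x))"
      by (simp add: quadratic_form_eq_sum[OF P x] quadratic_form_eq_sum[OF B x]
          sum_distrib_left mult_ac)
    then have lim: "(\<lambda>m. \<Sum>k\<le>m. sqrt_coeff k * (x \<bullet> (P k *\<^sub>v x))) \<longlonglongrightarrow> x \<bullet> (B *\<^sub>v x)"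
      by (simp add: sums_def_le)
    have "0 \<le> (\<Sum>k\<le>m. sqrt_coeff k * (x \<bullet> (P k *\<^sub>v x)))" for m
    proof -
      \<comment> \<open>Replacing each form \<open>x \<bullet> (P k *\<^sub>v x)\<close> by its
        upper bound \<open>x \<bullet> x\<close> can only lower the sum: the coefficients for
        \<open>k > 0\<close> are nonpositive, and for \<open>k = 0\<close> nothing changes.\<close>
      have "0 \<le> (\<Sum>k\<le>m. sqrt_coeff k) * (x \<bullet> x)"
        by (intro mult_nonneg_nonneg sum_sqrt_coeff_nonneg scalar_prod_self_nonneg)
      also have "\<dots> \<le> (\<Sum>k\<le>m. sqrt_coeff k * (x \<bullet> (P k *\<^sub>v x)))"
        unfolding sum_distrib_right
      proof (rule sum_mono)
        fix k
        show "sqrt_coeff k * (x \<bullet> x) \<le> sqrt_coeff k * (x \<bullet> (P k *\<^sub>v x))"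
        proof (cases "k = 0")
          case True
          then show ?thesis using R x by (simp add: P_def)
        next
          case False
          have "x \<bullet> (P k *\<^sub>v x) \<le> x \<bullet> x"
            using form_le[OF x x, of k] by simp
          then show ?thesis
            using sqrt_coeff_nonpos[of k] False by (intro mult_left_mono_neg) auto
        qed
      qed
      finally show ?thesis .
    qed
    then show ?thesis
      using LIMSEQ_le_const[OF lim] by blast
  qed
  ultimately have "psd_mat B"
    using psd_mat_iff[OF B] by blast
  moreover have "B * B = 1\<^sub>m n - R"
  proof (rule eq_matI)
    fix i j assume "i < dim_row (1\<^sub>m n - R)" "j < dim_col (1\<^sub>m n - R)"
    then have ij: "i < n" "j < n" using R by auto
    \<comment> \<open>One Cauchy product for each inner index \<open>l\<close> of the matrix
      product. Summing over \<open>l\<close> before \<open>p\<close> then merges \<open>P p\<close>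
      and \<open>P (k - p)\<close> into \<open>P k\<close>, leaving the scalar convolution.\<close>
    have "(\<lambda>k. \<Sum>l<n. \<Sum>p\<le>k. (sqrt_coeff p * P p $$ (i, l)) * (sqrt_coeff (k - p) * P (k - p) $$ (l, j)))
        sums (\<Sum>l<n. B $$ (i, l) * B $$ (l, j))"
    proof (rule sums_sum)
      fix l assume "l \<in> {..<n}"
      then have l: "l < n" by simp
      show "(\<lambda>k. \<Sum>p\<le>k. (sqrt_coeff p * P p $$ (i, l)) * (sqrt_coeff (k - p) * P (k - p) $$ (l, j)))
          sums (B $$ (i, l) * B $$ (l, j))"
        using Cauchy_product_sums[OF sm[OF ij(1) l] sm[OF l ij(2)]]
          sums_unique[OF B_sums[OF ij(1) l]] sums_unique[OF B_sums[OF l ij(2)]] by simp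
    qed
    moreover have "(\<Sum>l<n. \<Sum>p\<le>k. (sqrt_coeff p * P p $$ (i, l)) * (sqrt_coeff (k - p) * P (k - p) $$ (l, j)))
        = (if k = 0 then 1 else if k = 1 then -1 else 0) * P k $$ (i, j)" for k
    proof -
      have "(\<Sum>l<n. \<Sum>p\<le>k. (sqrt_coeff p * P p $$ (i, l)) * (sqrt_coeff (k - p) * P (k - p) $$ (l, j)))
          = (\<Sum>p\<le>k. \<Sum>l<n. (sqrt_coeff p * P p $$ (i, l)) * (sqrt_coeff (k - p) * P (k - p) $$ (l, j)))"
        by (rule sum.swap)
      also have "\<dots> = (\<Sum>p\<le>k. sqrt_coeff p * sqrt_coeff (k - p) * P k $$ (i, j))"
      proof (rule sum.cong)
        fix p assume "p \<in> {..k}"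
        then have "P k = P p * P (k - p)"
          unfolding P_def using pow_mat_add[OF R, of p "k - p"] by simp
        then show "(\<Sum>l<n. (sqrt_coeff p * P p $$ (i, l)) * (sqrt_coeff (k - p) * P (k - p) $$ (l, j)))
            = sqrt_coeff p * sqrt_coeff (k - p) * P k $$ (i, j)"
          by (simp add: index_mult_mat_sum[OF P P ij] sum_distrib_left mult_ac)
      qed simp
      also have "\<dots> = (if k = 0 then 1 else if k = 1 then -1 else 0) * P k $$ (i, j)"
        by (simp only: sqrt_coeff_convolution flip: sum_distrib_right)
      finally show ?thesis .
    qed
    ultimately have "(\<lambda>k. (if k = 0 then 1 else if k = 1 then -1 else 0) * P k $$ (i, j))
        sums ((B * B) $$ (i, j))"
      by (simp only: index_mult_mat_sum[OF B B ij])
    moreover have "(\<lambda>k. (if k = 0 then 1 else if k = 1 then -1 else 0) * P k $$ (i, j))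
        sums (\<Sum>k\<in>{0, 1}. (if k = 0 then 1 else if k = 1 then -1 else 0) * P k $$ (i, j))"
      by (rule sums_finite) auto
    ultimately have "(B * B) $$ (i, j) = P 0 $$ (i, j) - P 1 $$ (i, j)"
      by (simp add: sums_unique2)
    then show "(B * B) $$ (i, j) = (1\<^sub>m n - R) $$ (i, j)"
      using R ij by (simp add: P_def)
  qed (use B R in auto)
  ultimately show ?thesis using B by blast
qed

section \<open>Existence of the square root of a semidefinite matrix\<close>

lemma transpose_smult_mat:
  "transpose_mat (c \<cdot>\<^sub>m A) = c \<cdot>\<^sub>m transpose_mat A"
  by (rule eq_matI) auto

lemma psd_mat_smult:
  assumes B: "B \<in> carrier_mat n n" and "psd_mat B" and "c \<ge> 0"
  shows "psd_mat (c \<cdot>\<^sub>m B)"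
proof -
  have "x \<bullet> ((c \<cdot>\<^sub>m B) *\<^sub>v x) = c * (x \<bullet> (B *\<^sub>v x))" if "x \<in> carrier_vec n" for x
    using B that by (simp add: smult_mat_mult_vec[OF B] scalar_prod_smult_distrib[of _ n])
  then show ?thesis
    using assms psd_mat_iff[OF B] psd_mat_iff[of "c \<cdot>\<^sub>m B" n]
    by (simp add: transpose_smult_mat)
qed

lemma psd_mat_mult_transpose:
  assumes A: "A \<in> carrier_mat n n"
  shows "psd_mat (A * transpose_mat A)"
proof -
  have "x \<bullet> (A * transpose_mat A *\<^sub>v x) = (transpose_mat A *\<^sub>v x) \<bullet> (transpose_mat A *\<^sub>v x)"
    if "x \<in> carrier_vec n" for x
    using transpose_vec_mult_scalar[OF A, of "transpose_mat A *\<^sub>v x" x] A that by simp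
  moreover have "transpose_mat (A * transpose_mat A) = A * transpose_mat A"
    using A by (simp add: transpose_mult[of _ n n])
  ultimately show ?thesis
    using A by (simp add: psd_mat_iff[of _ n] scalar_prod_self_nonneg)
qed

text \<open>For large \<open>t\<close> the matrix \<open>R = 1 - M / t\<close> is a symmetric
  contraction. The root \<open>C\<close> of \<open>1 - R = M / t\<close> is then scaled by
  \<open>sqrt t\<close>.\<close>

lemma psd_sqrt_exists:
  assumes M: "M \<in> carrier_mat n n" and psd: "psd_mat M"
  shows "\<exists>B \<in> carrier_mat n n. psd_mat B \<and> B * B = M"
proof -
  have sym: "transpose_mat M = M" and nonneg: "\<And>z. z \<in> carrier_vec n \<Longrightarrow> 0 \<le> z \<bullet> (M *\<^sub>v z)"
    using psd psd_mat_iff[OF M] by auto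
  have Mv: "M *\<^sub>v z \<in> carrier_vec n" for z
    using M by (intro carrier_vecI) auto
  define s where "s = (\<Sum>i<n. row M i \<bullet> row M i)"
  \<comment> \<open>Here \<open>s\<close> is the squared Frobenius norm of \<open>M\<close>. Adding
    1 gives both \<open>t > 0\<close> and \<open>s \<le> t^2\<close>, so \<open>t\<close> bounds the
    operator norm.\<close>
  define t where "t = 1 + s"
  have "s \<ge> 0"
    unfolding s_def by (intro sum_nonneg scalar_prod_self_nonneg)
  then have t: "t > 0" "s \<le> t\<^sup>2"
    by (auto simp: t_def power2_eq_square algebra_simps)
  \<comment> \<open>With the identity matrix, \<open>psd_Cauchy_Schwarz\<close> becomes the ordinary
    Cauchy-Schwarz inequality, applied below to each row of \<open>M\<close>.\<close>
  have one: "psd_mat (1\<^sub>m n :: real mat)"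
    by (simp add: psd_mat_iff[of _ n] scalar_prod_self_nonneg)
  have bound: "(M *\<^sub>v x) \<bullet> (M *\<^sub>v x) \<le> t\<^sup>2 * (x \<bullet> x)" if x: "x \<in> carrier_vec n" for x
  proof -
    have "(M *\<^sub>v x) \<bullet> (M *\<^sub>v x) = (\<Sum>i<n. (row M i \<bullet> x)\<^sup>2)"
      using M by (auto simp: scalar_prod_def[of "M *\<^sub>v x"] lessThan_atLeast0 power2_eq_square)
    also have "\<dots> \<le> (\<Sum>i<n. (row M i \<bullet> row M i) * (x \<bullet> x))"
    proof (rule sum_mono)
      fix i
      have "row M i \<in> carrier_vec n" using M by auto
      then show "(row M i \<bullet> x)\<^sup>2 \<le> (row M i \<bullet> row M i) * (x \<bullet> x)"
        using psd_Cauchy_Schwarz[OF one_carrier_mat one _ x, of "row M i"] x by simp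
    qed
    also have "\<dots> = s * (x \<bullet> x)"
      by (simp add: s_def sum_distrib_right)
    also have "\<dots> \<le> t\<^sup>2 * (x \<bullet> x)"
      using t by (intro mult_right_mono scalar_prod_self_nonneg)
    finally show ?thesis .
  qed
  define R where "R = 1\<^sub>m n - (1 / t) \<cdot>\<^sub>m M"
  have R: "R \<in> carrier_mat n n"
    using M by (simp add: R_def minus_carrier_mat)
  have "transpose_mat R = R"
    using M sym unfolding R_def by (subst transpose_minus[of _ n n]) (simp_all add: transpose_smult_mat)
  moreover have "(R *\<^sub>v x) \<bullet> (R *\<^sub>v x) \<le> x \<bullet> x" if x: "x \<in> carrier_vec n" for x
  proof -
    have "R *\<^sub>v x = x + (- 1 / t) \<cdot>\<^sub>v (M *\<^sub>v x)"
      using M x unfolding R_def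
      by (subst minus_mult_distrib_mat_vec[of _ n n])
        (auto simp: smult_mat_mult_vec[OF M x] intro!: eq_vecI)
    then have "(R *\<^sub>v x) \<bullet> (R *\<^sub>v x)
        = x \<bullet> x - 2 / t * (x \<bullet> (M *\<^sub>v x)) + ((M *\<^sub>v x) \<bullet> (M *\<^sub>v x)) / t\<^sup>2"
      using scalar_prod_add_smult[OF x Mv x Mv, of "- 1 / t" x x] sym_mat_scalar_prod[OF M sym x x]
      by (simp add: power_divide)
    \<comment> \<open>By \<open>psd_norm_sq_le\<close> the quadratic term is at most half of the
      linear term that is subtracted.\<close>
    also have "((M *\<^sub>v x) \<bullet> (M *\<^sub>v x)) / t\<^sup>2 \<le> (t * (x \<bullet> (M *\<^sub>v x))) / t\<^sup>2"
      using psd_norm_sq_le[OF M psd t(1) bound x] by (simp add: divide_right_mono)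
    also have "(t * (x \<bullet> (M *\<^sub>v x))) / t\<^sup>2 \<le> 2 / t * (x \<bullet> (M *\<^sub>v x))"
      using t nonneg[OF x] by (simp add: power2_eq_square divide_right_mono)
    finally show ?thesis by simp
  qed
  ultimately obtain C where C: "C \<in> carrier_mat n n" "psd_mat C" "C * C = 1\<^sub>m n - R"
    using contraction_sqrt_exists[OF R] by blast
  have "1\<^sub>m n - R = (1 / t) \<cdot>\<^sub>m M"
    using M by (auto simp: R_def intro!: eq_matI)
  then have "(sqrt t \<cdot>\<^sub>m C) * (sqrt t \<cdot>\<^sub>m C) = sqrt t \<cdot>\<^sub>m (sqrt t \<cdot>\<^sub>m ((1 / t) \<cdot>\<^sub>m M))"
    using C by (simp add: mult_smult_distrib[of _ n n _ n] mult_smult_assoc_mat[of _ n n _ n])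
  also have "\<dots> = M"
  proof (rule eq_matI)
    fix i j assume "i < dim_row M" "j < dim_col M"
    then show "(sqrt t \<cdot>\<^sub>m (sqrt t \<cdot>\<^sub>m ((1 / t) \<cdot>\<^sub>m M))) $$ (i, j) = M $$ (i, j)"
      using t by (simp flip: mult.assoc)
  qed auto
  finally show ?thesis
    using C psd_mat_smult[OF C(1,2), of "sqrt t"] t by (intro bexI[of _ "sqrt t \<cdot>\<^sub>m C"]) auto
qed

section \<open>Uniqueness of the square root and the matrix absolute value\<close>

lemma trace_mult_commute:
  fixes X Y :: "real mat"
  assumes "X \<in> carrier_mat n n" "Y \<in> carrier_mat n n"
  shows "(\<Sum>i<n. (X * Y) $$ (i, i)) = (\<Sum>i<n. (Y * X) $$ (i, i))"
proof -
  have "(\<Sum>i<n. (X * Y) $$ (i, i)) = (\<Sum>i<n. \<Sum>l<n. X $$ (i, l) * Y $$ (l, i))"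
    using assms by (simp add: index_mult_mat_sum del: index_mult_mat(1))
  also have "\<dots> = (\<Sum>l<n. \<Sum>i<n. Y $$ (l, i) * X $$ (i, l))"
    by (subst sum.swap) (simp add: mult.commute)
  also have "\<dots> = (\<Sum>l<n. (Y * X) $$ (l, l))"
    using assms by (simp add: index_mult_mat_sum del: index_mult_mat(1))
  finally show ?thesis .
qed

text \<open>
  With \<open>D = B - C\<close> one has \<open>B D = - D C\<close>, so the traces of the positive semidefinite matrices
  \<open>D B D\<close> and \<open>D C D\<close> add up to zero. Hence \<open>B D = C D = 0\<close> and \<open>D\<^sup>2 = 0\<close>.
\<close>

lemma psd_sqrt_unique:
  assumes B: "B \<in> carrier_mat n n" "psd_mat B" and C: "C \<in> carrier_mat n n" "psd_mat C"
    and eq: "B * B = C * C"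
  shows "B = C"
proof -
  define D where "D = B - C"
  have D: "D \<in> carrier_mat n n"
    using B C by (simp add: D_def minus_carrier_mat)
  have symB: "transpose_mat B = B" and nonnegB: "\<And>z. z \<in> carrier_vec n \<Longrightarrow> 0 \<le> z \<bullet> (B *\<^sub>v z)"
    using B psd_mat_iff[OF B(1)] by auto
  have symC: "transpose_mat C = C" and nonnegC: "\<And>z. z \<in> carrier_vec n \<Longrightarrow> 0 \<le> z \<bullet> (C *\<^sub>v z)"
    using C psd_mat_iff[OF C(1)] by auto
  have symD: "transpose_mat D = D"
    unfolding D_def using B C symB symC by (subst transpose_minus[of _ n n]) simp_all
  have anti: "B * D = - (D * C)"
  proof -
    have "B * D = B * B - B * C" "D * C = B * C - C * C"
      unfolding D_def using B C
      by (simp_all add: mult_minus_distrib_mat[of _ n n] minus_mult_distrib_mat[of _ n n])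
    then show ?thesis
      using B C eq by (auto intro!: eq_matI)
  qed
  define u where "u i = D *\<^sub>v unit_vec n i" for i
  have u: "u i \<in> carrier_vec n" for i
    using D by (intro carrier_vecI) (auto simp: u_def)
  \<comment> \<open>Since \<open>D\<close> is symmetric, the diagonal of \<open>D X D\<close>
    consists of the values of the form of \<open>X\<close> at the columns of
    \<open>D\<close>.\<close>
  have diag: "(D * (X * D)) $$ (i, i) = u i \<bullet> (X *\<^sub>v u i)"
    if X: "X \<in> carrier_mat n n" and i: "i < n" for X i
  proof -
    have Xv: "X *\<^sub>v z \<in> carrier_vec n" for z
      using X by (intro carrier_vecI) auto
    have "(D * (X * D)) $$ (i, i) = unit_vec n i \<bullet> (D * (X * D) *\<^sub>v unit_vec n i)"
      using index_mat_scalar_prod[of "D * (X * D)" n i i] D X i by simp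
    also have "D * (X * D) *\<^sub>v unit_vec n i = D *\<^sub>v (X *\<^sub>v u i)"
      using D X by (simp add: u_def assoc_mult_mat_vec[of _ n n _ n])
    also have "unit_vec n i \<bullet> \<dots> = u i \<bullet> (X *\<^sub>v u i)"
      using sym_mat_scalar_prod[OF D symD _ Xv, of "unit_vec n i" "u i"] by (simp add: u_def)
    finally show ?thesis .
  qed
  have "(\<Sum>i<n. (D * (B * D)) $$ (i, i)) = (\<Sum>i<n. - (D * (D * C)) $$ (i, i))"
    using D C(1) by (simp add: anti)
  also have "\<dots> = - (\<Sum>i<n. (D * (C * D)) $$ (i, i))"
    using trace_mult_commute[of D n "D * C"] D C(1) by (simp add: sum_negf)
  finally have "(\<Sum>i<n. u i \<bullet> (B *\<^sub>v u i) + u i \<bullet> (C *\<^sub>v u i)) = 0"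
    using B(1) C(1) by (simp add: diag sum.distrib)
  then have *: "\<forall>i<n. u i \<bullet> (B *\<^sub>v u i) + u i \<bullet> (C *\<^sub>v u i) = 0"
    using nonnegB[OF u] nonnegC[OF u] by (subst (asm) sum_nonneg_eq_0_iff) auto
  have "u i = 0\<^sub>v n" if i: "i < n" for i
  proof -
    have "u i \<bullet> (B *\<^sub>v u i) = 0 \<and> u i \<bullet> (C *\<^sub>v u i) = 0"
      using * i nonnegB[OF u, of i] nonnegC[OF u, of i] by (metis add_nonneg_eq_0_iff)
    then have "B *\<^sub>v u i = 0\<^sub>v n" "C *\<^sub>v u i = 0\<^sub>v n"
      using psd_quadratic_form_eq_0[OF B u] psd_quadratic_form_eq_0[OF C u] by auto
    then have "D *\<^sub>v u i = 0\<^sub>v n"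
      using B(1) C(1) u[of i] unfolding D_def by (simp add: minus_mult_distrib_mat_vec[of _ n n])
    \<comment> \<open>Since \<open>u i\<close> is \<open>D\<close> applied to a unit vector,
      symmetry moves one factor \<open>D\<close> across the product, onto \<open>u i\<close>, where
      it gives zero.\<close>
    then have "u i \<bullet> u i = 0"
      using sym_mat_scalar_prod[OF D symD, of "unit_vec n i" "u i"] u[of i] by (simp add: u_def)
    then show ?thesis
      using scalar_prod_self_eq_0[OF u] by simp
  qed
  then have "D $$ (i, j) = 0" if "i < n" "j < n" for i j
    using index_mat_scalar_prod[OF D that] that by (simp add: u_def)
  then show ?thesis
    using B(1) C(1) by (intro eq_matI) (auto simp: D_def)
qed

text \<open>Uniqueness resolves the definite description, so exhibiting one semidefinite root
  computes \<open>psd_sqrt\<close>.\<close>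

lemma psd_sqrt_eqI:
  assumes "B \<in> carrier_mat n n" "psd_mat B" "B * B = M"
  shows "psd_sqrt M = B"
proof -
  have dim: "dim_row M = n" using assms by auto
  show ?thesis
    unfolding psd_sqrt_def dim
  proof (rule the_equality)
    fix C assume C: "C \<in> carrier_mat n n \<and> psd_mat C \<and> C * C = M"
    then have "C * C = B * B"
      using assms(3) by simp
    with C show "C = B"
      using psd_sqrt_unique[OF _ _ assms(1,2)] by blast
  qed (simp add: assms)
qed

lemma
  assumes M: "M \<in> carrier_mat n n" and psd: "psd_mat M"
  shows psd_sqrt_carrier: "psd_sqrt M \<in> carrier_mat n n"
    and psd_mat_psd_sqrt: "psd_mat (psd_sqrt M)"
    and psd_sqrt_square: "psd_sqrt M * psd_sqrt M = M"
proof -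
  obtain B where "B \<in> carrier_mat n n" "psd_mat B" "B * B = M"
    using psd_sqrt_exists[OF assms] by blast
  with psd_sqrt_eqI[OF this]
  show "psd_sqrt M \<in> carrier_mat n n" "psd_mat (psd_sqrt M)" "psd_sqrt M * psd_sqrt M = M"
    by blast+
qed

lemma
  assumes A: "A \<in> carrier_mat n n"
  shows mat_abs_carrier: "mat_abs A \<in> carrier_mat n n"
    and psd_mat_mat_abs: "psd_mat (mat_abs A)"
    and mat_abs_square: "mat_abs A * mat_abs A = A * transpose_mat A"
  using psd_sqrt_carrier[of "A * transpose_mat A" n] psd_mat_psd_sqrt[of "A * transpose_mat A" n]
    psd_sqrt_square[of "A * transpose_mat A" n] psd_mat_mult_transpose[OF A] A
  by (simp_all add: mat_abs_def mat_adjoint_real)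

section \<open>Diagonal entries of the absolute value of a symmetric matrix\<close>

text \<open>The matrix form of \<open>psd_norm_sq_le\<close>. As a semidefiniteness statement it
  also gives access to \<open>psd_quadratic_form_eq_0\<close>, which settles the case of
  equality.\<close>

lemma psd_mat_smult_minus_square:
  assumes B: "B \<in> carrier_mat n n" and psd: "psd_mat B" and t: "t > 0"
    and bound: "\<And>y. y \<in> carrier_vec n \<Longrightarrow> (B *\<^sub>v y) \<bullet> (B *\<^sub>v y) \<le> t\<^sup>2 * (y \<bullet> y)"
  shows "psd_mat (t \<cdot>\<^sub>m B - B * B)"
proof -
  have sym: "transpose_mat B = B"
    using psd psd_mat_iff[OF B] by auto
  have Bv: "B *\<^sub>v z \<in> carrier_vec n" for z
    using B by (intro carrier_vecI) auto
  have "0 \<le> x \<bullet> ((t \<cdot>\<^sub>m B - B * B) *\<^sub>v x)" if x: "x \<in> carrier_vec n" for x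
  proof -
    have "(t \<cdot>\<^sub>m B - B * B) *\<^sub>v x = t \<cdot>\<^sub>v (B *\<^sub>v x) - B *\<^sub>v (B *\<^sub>v x)"
      using B x by (simp add: minus_mult_distrib_mat_vec[of _ n n] smult_mat_mult_vec[OF B x])
    then have "x \<bullet> ((t \<cdot>\<^sub>m B - B * B) *\<^sub>v x) = t * (x \<bullet> (B *\<^sub>v x)) - (B *\<^sub>v x) \<bullet> (B *\<^sub>v x)"
      using x Bv sym_mat_scalar_prod[OF B sym x Bv[of x]]
      by (simp add: scalar_prod_minus_distrib[of _ n] scalar_prod_smult_distrib[of _ n])
    then show ?thesis
      using psd_norm_sq_le[OF B psd t bound x] by simp
  qed
  moreover have "transpose_mat (t \<cdot>\<^sub>m B - B * B) = t \<cdot>\<^sub>m B - B * B"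
    using B sym by (subst transpose_minus[of _ n n]) (simp_all add: transpose_smult_mat transpose_mult[of _ n n])
  ultimately show ?thesis
    using B by (simp add: psd_mat_iff[of _ n] minus_carrier_mat)
qed

lemma
  assumes A: "A \<in> carrier_mat n n" and sym: "transpose_mat A = A" and t: "t > 0"
    and bound: "\<And>y. y \<in> carrier_vec n \<Longrightarrow> (A *\<^sub>v y) \<bullet> (A *\<^sub>v y) \<le> t\<^sup>2 * (y \<bullet> y)"
    and i: "i < n"
  shows mat_abs_diag_ge: "(A * A) $$ (i, i) / t \<le> mat_abs A $$ (i, i)"
    and mat_abs_diag_eqD: "mat_abs A $$ (i, i) = (A * A) $$ (i, i) / t
      \<Longrightarrow> A *\<^sub>v (A *\<^sub>v (A *\<^sub>v unit_vec n i)) = t\<^sup>2 \<cdot>\<^sub>v (A *\<^sub>v unit_vec n i)"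
proof -
  define B where "B = mat_abs A"
  have B: "B \<in> carrier_mat n n" and psd: "psd_mat B" and sq: "B * B = A * A"
    unfolding B_def using mat_abs_carrier[OF A] psd_mat_mat_abs[OF A] mat_abs_square[OF A] sym by auto
  have symB: "transpose_mat B = B"
    using psd psd_mat_iff[OF B] by auto
  have Bv: "B *\<^sub>v z \<in> carrier_vec n" for z
    using B by (intro carrier_vecI) auto
  have Av: "A *\<^sub>v z \<in> carrier_vec n" for z
    using A by (intro carrier_vecI) auto
  have sqv: "B *\<^sub>v (B *\<^sub>v y) = A *\<^sub>v (A *\<^sub>v y)" if "y \<in> carrier_vec n" for y
    using sq A B that by (metis assoc_mult_mat_vec)
  \<comment> \<open>As \<open>B^2 = A^2\<close> and both are symmetric, \<open>A y\<close> and
    \<open>B y\<close> have the same length, so \<open>B\<close> inherits the bound.\<close>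
  have boundB: "(B *\<^sub>v y) \<bullet> (B *\<^sub>v y) \<le> t\<^sup>2 * (y \<bullet> y)" if y: "y \<in> carrier_vec n" for y
    using bound[OF y] sym_mat_scalar_prod[OF A sym y Av[of y]]
      sym_mat_scalar_prod[OF B symB y Bv[of y]] sqv[OF y] by simp
  define M where "M = t \<cdot>\<^sub>m B - B * B"
  have M: "M \<in> carrier_mat n n"
    using B by (simp add: M_def minus_carrier_mat)
  have psdM: "psd_mat M"
    unfolding M_def by (rule psd_mat_smult_minus_square[OF B psd t boundB])
  define e :: "real vec" where "e = unit_vec n i"
  have e: "e \<in> carrier_vec n"
    by (simp add: e_def)
  have diag: "e \<bullet> (M *\<^sub>v e) = t * B $$ (i, i) - (A * A) $$ (i, i)"
    using index_mat_scalar_prod[OF M i i] A B i sq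
    by (simp add: e_def M_def del: index_mult_mat(1))
  moreover have "0 \<le> e \<bullet> (M *\<^sub>v e)"
    using psdM e psd_mat_iff[OF M] by auto
  ultimately show "(A * A) $$ (i, i) / t \<le> mat_abs A $$ (i, i)"
    using t by (simp add: B_def pos_divide_le_eq mult.commute)
  assume "mat_abs A $$ (i, i) = (A * A) $$ (i, i) / t"
  then have "e \<bullet> (M *\<^sub>v e) = 0"
    using diag t by (simp add: B_def)
  then have "M *\<^sub>v e = 0\<^sub>v n"
    by (rule psd_quadratic_form_eq_0[OF M psdM e])
  define y where "y = B *\<^sub>v e"
  have y: "y \<in> carrier_vec n"
    by (simp add: y_def Bv)
  have "M *\<^sub>v e = t \<cdot>\<^sub>v y - B *\<^sub>v y"
    unfolding M_def y_def using B e
    by (simp add: minus_mult_distrib_mat_vec[of _ n n] smult_mat_mult_vec[OF B e])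
  \<comment> \<open>\<open>M e = 0\<close> says that \<open>y = B e\<close> is an eigenvector of
    \<open>B\<close> for \<open>t\<close> or zero; hence \<open>A^2 y = t^2 y\<close>.\<close>
  have By: "B *\<^sub>v y = t \<cdot>\<^sub>v y"
  proof (rule eq_vecI)
    fix k assume "k < dim_vec (t \<cdot>\<^sub>v y)"
    then have k: "k < n" using y by simp
    have "(t \<cdot>\<^sub>v y - B *\<^sub>v y) $ k = 0"
      using \<open>M *\<^sub>v e = 0\<^sub>v n\<close> \<open>M *\<^sub>v e = t \<cdot>\<^sub>v y - B *\<^sub>v y\<close> k by simp
    moreover have "(t \<cdot>\<^sub>v y - B *\<^sub>v y) $ k = (t \<cdot>\<^sub>v y) $ k - (B *\<^sub>v y) $ k"
      using k y B Bv[of y] by (intro index_minus_vec) auto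
    ultimately show "(B *\<^sub>v y) $ k = (t \<cdot>\<^sub>v y) $ k"
      by simp
  qed (use B y in auto)
  then have AAe: "A *\<^sub>v (A *\<^sub>v e) = t \<cdot>\<^sub>v y"
    using sqv[OF e] by (simp add: y_def)
  have AAy: "A *\<^sub>v (A *\<^sub>v y) = t\<^sup>2 \<cdot>\<^sub>v y"
    using sqv[OF y] By mult_mat_vec[OF B y, of t] by (simp add: smult_smult_assoc power2_eq_square)
  \<comment> \<open>The target is \<open>w = (A^3 - t^2 A) e = 0\<close>. The eigenvector equation
    only gives \<open>A w = 0\<close>, but \<open>w = A z\<close> with \<open>A\<close> symmetric,
    so \<open>w \<bullet> w = (A *\<^sub>v w) \<bullet> z = 0\<close>.\<close>
  define z w where "z = A *\<^sub>v (A *\<^sub>v e) + (- t\<^sup>2) \<cdot>\<^sub>v e" and "w = A *\<^sub>v z"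
  have z: "z \<in> carrier_vec n" and w: "w \<in> carrier_vec n"
    using e by (simp_all add: z_def w_def Av)
  have w_eq: "w = A *\<^sub>v (A *\<^sub>v (A *\<^sub>v e)) + (- t\<^sup>2) \<cdot>\<^sub>v (A *\<^sub>v e)"
    unfolding w_def z_def by (rule mult_add_smult_vec[OF A Av e])
  have "A *\<^sub>v w = A *\<^sub>v (A *\<^sub>v (A *\<^sub>v (A *\<^sub>v e))) + (- t\<^sup>2) \<cdot>\<^sub>v (A *\<^sub>v (A *\<^sub>v e))"
    unfolding w_eq by (rule mult_add_smult_vec[OF A Av Av])
  also have "\<dots> = t \<cdot>\<^sub>v (t\<^sup>2 \<cdot>\<^sub>v y) + (- t\<^sup>2) \<cdot>\<^sub>v (t \<cdot>\<^sub>v y)"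
    unfolding AAe using mult_mat_vec[OF A y] mult_mat_vec[OF A Av] by (simp add: AAy)
  also have "\<dots> = 0\<^sub>v n"
    using y by (auto intro!: eq_vecI)
  finally have "w \<bullet> w = 0"
    using sym_mat_scalar_prod[OF A sym w z] z by (simp add: w_def)
  then have "w = 0\<^sub>v n"
    using scalar_prod_self_eq_0[OF w] by simp
  show "A *\<^sub>v (A *\<^sub>v (A *\<^sub>v unit_vec n i)) = t\<^sup>2 \<cdot>\<^sub>v (A *\<^sub>v unit_vec n i)"
  proof (rule eq_vecI)
    fix k assume "k < dim_vec (t\<^sup>2 \<cdot>\<^sub>v (A *\<^sub>v unit_vec n i))"
    then have k: "k < n" using A by simp
    have "0 = (A *\<^sub>v (A *\<^sub>v (A *\<^sub>v e)) + (- t\<^sup>2) \<cdot>\<^sub>v (A *\<^sub>v e)) $ k"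
      using \<open>w = 0\<^sub>v n\<close> k by (simp flip: w_eq)
    also have "\<dots> = (A *\<^sub>v (A *\<^sub>v (A *\<^sub>v e))) $ k + ((- t\<^sup>2) \<cdot>\<^sub>v (A *\<^sub>v e)) $ k"
      using k A by (intro index_add_vec) auto
    also have "((- t\<^sup>2) \<cdot>\<^sub>v (A *\<^sub>v e)) $ k = - (t\<^sup>2 \<cdot>\<^sub>v (A *\<^sub>v e)) $ k"
      using k A by simp
    finally show "(A *\<^sub>v (A *\<^sub>v (A *\<^sub>v unit_vec n i))) $ k = (t\<^sup>2 \<cdot>\<^sub>v (A *\<^sub>v unit_vec n i)) $ k"
      by (simp only: e_def)
  qed (use A in auto)
qed

section \<open>An operator norm bound from row sums\<close>

text \<open>Cauchy-Schwarz with weights: \<open>2 x_j x_k \<le> x_j^2 + x_k^2\<close> is summed over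
  all pairs with the nonnegative weights \<open>a_j a_k\<close>.\<close>

lemma weighted_sum_square_le:
  fixes a x :: "'b \<Rightarrow> real"
  assumes "\<And>j. j \<in> S \<Longrightarrow> a j \<ge> 0"
  shows "(\<Sum>j\<in>S. a j * x j)\<^sup>2 \<le> (\<Sum>j\<in>S. a j) * (\<Sum>j\<in>S. a j * (x j)\<^sup>2)"
proof -
  have "2 * (\<Sum>j\<in>S. a j * x j)\<^sup>2 = (\<Sum>j\<in>S. \<Sum>k\<in>S. (a j * a k) * (2 * x j * x k))"
    by (simp add: power2_eq_square sum_product sum_distrib_left mult_ac)
  also have "\<dots> \<le> (\<Sum>j\<in>S. \<Sum>k\<in>S. (a j * a k) * ((x j)\<^sup>2 + (x k)\<^sup>2))"
    using assms by (intro sum_mono mult_left_mono mult_nonneg_nonneg sum_squares_bound)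
  also have "\<dots> = (\<Sum>j\<in>S. \<Sum>k\<in>S. a k * (a j * (x j)\<^sup>2)) + (\<Sum>j\<in>S. \<Sum>k\<in>S. a j * (a k * (x k)\<^sup>2))"
    by (simp add: algebra_simps sum.distrib)
  also have "\<dots> = 2 * ((\<Sum>j\<in>S. a j) * (\<Sum>j\<in>S. a j * (x j)\<^sup>2))"
    by (simp add: sum.swap[of "\<lambda>j k. a k * (a j * (x j)\<^sup>2)"] flip: sum_product)
  finally show ?thesis by simp
qed

text \<open>Schur's test: weighted Cauchy-Schwarz in each row gives one factor \<open>t\<close>.
  After exchanging the sums, column sums appear, which by symmetry are row sums and give the other
  factor.\<close>

lemma sym_nonneg_mat_norm_sq_le:
  fixes A :: "real mat"
  assumes A: "A \<in> carrier_mat n n" and sym: "transpose_mat A = A"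
    and nonneg: "\<And>i j. i < n \<Longrightarrow> j < n \<Longrightarrow> A $$ (i, j) \<ge> 0"
    and row_sum: "\<And>i. i < n \<Longrightarrow> (\<Sum>j<n. A $$ (i, j)) \<le> t"
    and x: "x \<in> carrier_vec n"
  shows "(A *\<^sub>v x) \<bullet> (A *\<^sub>v x) \<le> t\<^sup>2 * (x \<bullet> x)"
proof (cases "n = 0")
  case True
  then show ?thesis using A x by (simp add: scalar_prod_def)
next
  case False
  \<comment> \<open>The sign of \<open>t\<close> comes from the sum of a nonnegative row, so at
    least one row must exist.\<close>
  then have t: "0 \<le> t"
    using row_sum[of 0] nonneg[of 0] sum_nonneg[of "{..<n}" "\<lambda>j. A $$ (0, j)"] by force
  have "(A *\<^sub>v x) \<bullet> (A *\<^sub>v x) = (\<Sum>i<n. (\<Sum>j<n. A $$ (i, j) * x $ j)\<^sup>2)"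
    using A x by (auto simp: scalar_prod_def lessThan_atLeast0 power2_eq_square)
  also have "\<dots> \<le> (\<Sum>i<n. t * (\<Sum>j<n. A $$ (i, j) * (x $ j)\<^sup>2))"
  proof (rule sum_mono)
    fix i assume "i \<in> {..<n}"
    then have i: "i < n" by simp
    have "(\<Sum>j<n. A $$ (i, j) * x $ j)\<^sup>2
        \<le> (\<Sum>j<n. A $$ (i, j)) * (\<Sum>j<n. A $$ (i, j) * (x $ j)\<^sup>2)"
      using nonneg[OF i] by (intro weighted_sum_square_le) auto
    also have "\<dots> \<le> t * (\<Sum>j<n. A $$ (i, j) * (x $ j)\<^sup>2)"
      using nonneg[OF i] row_sum[OF i] by (intro mult_right_mono sum_nonneg) auto
    finally show "(\<Sum>j<n. A $$ (i, j) * x $ j)\<^sup>2 \<le> t * (\<Sum>j<n. A $$ (i, j) * (x $ j)\<^sup>2)" .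
  qed
  also have "\<dots> = t * (\<Sum>j<n. \<Sum>i<n. A $$ (j, i) * (x $ j)\<^sup>2)"
  proof -
    have "A $$ (i, j) = A $$ (j, i)" if "i < n" "j < n" for i j
      using that A sym by (metis carrier_matD index_transpose_mat(1))
    then show ?thesis
      by (subst sum.swap) (simp add: sum_distrib_left)
  qed
  also have "\<dots> = t * (\<Sum>j<n. (\<Sum>i<n. A $$ (j, i)) * (x $ j)\<^sup>2)"
    by (simp add: sum_distrib_right)
  also have "\<dots> \<le> t * (\<Sum>j<n. t * (x $ j)\<^sup>2)"
    using t row_sum by (intro mult_left_mono sum_mono mult_right_mono) auto
  also have "\<dots> = t\<^sup>2 * (x \<bullet> x)"
    using x by (simp add: scalar_prod_def lessThan_atLeast0 power2_eq_square sum_distrib_left mult_ac)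
  finally show ?thesis .
qed

section \<open>Complete bipartite graphs\<close>

lemma (in pair_wf_digraph) parcs_subset: "parcs G \<subseteq> pverts G \<times> pverts G"
  by (auto dest: in_arcsD1 in_arcsD2)

text \<open>An isomorphism record also carries maps for arcs, tails and heads. Between pair digraphs
  tails and heads are \<open>fst\<close> and \<open>snd\<close>, which forces the arc map to be
  \<open>map_prod f f\<close> on arcs, so only the vertex map is free.\<close>

lemma digraph_iso_with_proj_iff:
  "digraph_iso (with_proj G) (with_proj H) \<longleftrightarrow>
     pair_wf_digraph G \<and>
     (\<exists>f. inj_on f (pverts G) \<and> pverts H = f ` pverts G \<and> parcs H = map_prod f f ` parcs G)"
    (is "?L \<longleftrightarrow> ?R")
proof
  assume ?L
  then obtain h where h: "pre_digraph.digraph_isomorphism (with_proj G) h"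
    and H: "with_proj H = app_iso h (with_proj G)"
    unfolding digraph_iso_def by blast
  let ?f = "iso_verts h"
  have ends: "iso_tail h = fst" "iso_head h = snd"
    using H by (metis tail_app_iso with_proj_simps(4)) (metis H head_app_iso with_proj_simps(5))
  have wf: "wf_digraph (with_proj G)" and inj: "inj_on ?f (pverts G)"
    and arcs: "\<And>a. a \<in> parcs G \<Longrightarrow> ?f (fst a) = fst (iso_arcs h a) \<and> ?f (snd a) = snd (iso_arcs h a)"
    using h by (auto simp: pre_digraph.digraph_isomorphism_def ends)
  have "pverts H = ?f ` pverts G"
    using H by (metis verts_app_iso with_proj_simps(1))
  moreover have "parcs H = map_prod ?f ?f ` parcs G"
  proof -
    have "parcs H = iso_arcs h ` parcs G"
      using H by (metis arcs_app_iso with_proj_simps(2))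
    also have "\<dots> = map_prod ?f ?f ` parcs G"
      using arcs by (intro image_cong) (auto simp: map_prod_def prod_eq_iff split: prod.splits)
    finally show ?thesis .
  qed
  moreover have "pair_wf_digraph G"
    using wf by (simp add: wf_digraph_wp_iff)
  ultimately show ?R
    using inj by blast
next
  assume ?R
  then obtain f where G: "pair_wf_digraph G" and f: "inj_on f (pverts G)"
    and H: "pverts H = f ` pverts G" "parcs H = map_prod f f ` parcs G"
    by blast
  define h where "h = \<lparr>iso_verts = f, iso_arcs = map_prod f f, iso_head = snd, iso_tail = fst\<rparr>"
  have "parcs G \<subseteq> pverts G \<times> pverts G"
    by (rule pair_wf_digraph.parcs_subset[OF G])
  then have "inj_on (map_prod f f) (parcs G)"
    using map_prod_inj_on[OF f f] inj_on_subset by blast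
  then have "pre_digraph.digraph_isomorphism (with_proj G) h"
    using G f by (auto simp: pre_digraph.digraph_isomorphism_def h_def wf_digraph_wp_iff)
  moreover have "with_proj H = app_iso h (with_proj G)"
    by (simp add: with_proj_def app_iso_def h_def H)
  ultimately show ?L
    unfolding digraph_iso_def by blast
qed

lemma map_prod_image_Times: "map_prod f g ` (A \<times> B) = f ` A \<times> g ` B"
  by (rule map_prod_surj_on) auto

text \<open>Replaces the concrete model on \<open>nat + nat\<close> by the existence of two sides
  inside \<open>G\<close>. The sides are the preimages of the \<open>Inl\<close> and
  \<open>Inr\<close> parts; conversely, enumerations of the sides are glued into a vertex
  map.\<close>

lemma digraph_iso_complete_bipartite_iff:
  assumes G: "pair_wf_digraph G"
  shows "digraph_iso (with_proj G) (with_proj (complete_bipartite m n))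
    \<longleftrightarrow> complete_bipartite_digraph m n (with_proj G)"
proof
  assume "digraph_iso (with_proj G) (with_proj (complete_bipartite m n))"
  then obtain f where inj: "inj_on f (pverts G)"
    and verts: "f ` pverts G = Inl ` {..<m} \<union> Inr ` {..<n}"
    and arcs: "map_prod f f ` parcs G
      = Inl ` {..<m} \<times> Inr ` {..<n} \<union> Inr ` {..<n} \<times> Inl ` {..<m}"
    unfolding digraph_iso_with_proj_iff complete_bipartite_def Let_def by auto
  define U V where "U = {x \<in> pverts G. f x \<in> Inl ` {..<m}}" and "V = {x \<in> pverts G. f x \<in> Inr ` {..<n}}"
  have sub: "parcs G \<subseteq> pverts G \<times> pverts G"
    by (rule pair_wf_digraph.parcs_subset[OF G])
  have "finite (f ` pverts G)"
    by (simp add: verts)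
  then have fin: "finite (pverts G)"
    using inj finite_imageD by blast
  have UV: "pverts G = U \<union> V" "U \<inter> V = {}"
    using verts by (auto simp: U_def V_def)
  have "f ` U = f ` pverts G \<inter> Inl ` {..<m}" "f ` V = f ` pverts G \<inter> Inr ` {..<n}"
    by (auto simp: U_def V_def)
  then have "f ` U = Inl ` {..<m}" "f ` V = Inr ` {..<n}"
    unfolding verts by auto
  moreover have "card (f ` U) = card U" "card (f ` V) = card V"
    using inj by (auto intro!: card_image inj_on_subset[OF inj] simp: U_def V_def)
  ultimately have cards: "card U = m" "card V = n"
    by (simp_all add: card_image)
  \<comment> \<open>Injectivity of \<open>f\<close> on the vertices reflects arcs of the image back
    to \<open>G\<close>.\<close>
  have "(x, y) \<in> parcs G \<longleftrightarrow> (f x, f y) \<in> map_prod f f ` parcs G"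
    if "x \<in> pverts G" "y \<in> pverts G" for x y
  proof
    assume "(f x, f y) \<in> map_prod f f ` parcs G"
    then obtain a b where ab: "(a, b) \<in> parcs G" "f x = f a" "f y = f b"
      by auto
    then have "x = a" "y = b"
      using inj_onD[OF inj] that sub by blast+
    then show "(x, y) \<in> parcs G"
      using ab by simp
  qed (simp add: rev_image_eqI)
  then have "parcs G = U \<times> V \<union> V \<times> U"
    unfolding arcs using sub by (auto simp: U_def V_def)
  with UV cards fin show "complete_bipartite_digraph m n (with_proj G)"
    unfolding complete_bipartite_digraph_pair_def by blast
next
  assume "complete_bipartite_digraph m n (with_proj G)"
  then obtain U V where fin: "finite (pverts G)" and UV: "pverts G = U \<union> V" "U \<inter> V = {}"
    and cards: "card U = m" "card V = n" and arcs: "parcs G = U \<times> V \<union> V \<times> U"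
    unfolding complete_bipartite_digraph_pair_def by blast
  have "finite U" "finite V"
    using fin UV by auto
  then obtain g h where g: "bij_betw g U {..<m}" and h: "bij_betw h V {..<n}"
    using cards by (metis atLeast0LessThan ex_bij_betw_finite_nat)
  define f where "f x = (if x \<in> U then Inl (g x) else Inr (h x))" for x
  have fU: "f ` U = Inl ` {..<m}" and fV: "f ` V = Inr ` {..<n}"
  proof -
    have "f ` U = Inl ` g ` U" "f ` V = Inr ` h ` V"
      unfolding image_image using UV(2) by (auto simp: f_def intro!: image_cong)
    then show "f ` U = Inl ` {..<m}" "f ` V = Inr ` {..<n}"
      using g h by (auto simp: bij_betw_def)
  qed
  have "inj_on f (pverts G)"
    using g h UV by (auto simp: f_def bij_betw_def inj_on_def)
  moreover have "pverts (complete_bipartite m n) = f ` pverts G"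
    by (simp add: complete_bipartite_def Let_def UV(1) image_Un fU fV)
  moreover have "parcs (complete_bipartite m n) = map_prod f f ` parcs G"
    by (simp add: complete_bipartite_def Let_def arcs image_Un map_prod_image_Times fU fV)
  ultimately show "digraph_iso (with_proj G) (with_proj (complete_bipartite m n))"
    unfolding digraph_iso_with_proj_iff using G by blast
qed

section \<open>Neighbourhoods, connectedness and maximal walk counts\<close>

lemma out_degree_with_proj: "out_degree (with_proj G) u = card (parcs G `` {u})"
proof -
  have "out_arcs (with_proj G) u = Pair u ` (parcs G `` {u})"
    by (auto simp: out_arcs_def)
  then show ?thesis
    by (simp add: out_degree_def card_image inj_on_def)
qed

text \<open>Arcs are symmetric, so connectedness makes every vertex reachable in \<open>G\<close>
  itself, and a set closed under arcs contains all that is reachable from its elements.\<close>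

lemma (in pair_graph) connected_closed_eq:
  assumes "Digraph_Component.connected (with_proj G)" and "S \<subseteq> pverts G" and "S \<noteq> {}"
    and closed: "\<And>u v. u \<in> S \<Longrightarrow> (u, v) \<in> parcs G \<Longrightarrow> v \<in> S"
  shows "S = pverts G"
proof -
  obtain u where u: "u \<in> S" using assms by auto
  have "v \<in> S" if "v \<in> pverts G" for v
  proof -
    have "u \<rightarrow>\<^sup>*\<^bsub>mk_symmetric (with_proj G)\<^esub> v"
      using assms u that by (auto simp: connected_def strongly_connected_def)
    then have "u \<rightarrow>\<^sup>*\<^bsub>with_proj G\<^esub> v"
      using reachable_mk_symmetric_eq sym_arcs by blast
    then show ?thesis
      by (induction rule: reachable_induct) (use u closed in auto)
  qed
  then show ?thesis using assms by auto
qed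

lemma (in pair_graph) sym_parcs: "(u, v) \<in> parcs G \<longleftrightarrow> (v, u) \<in> parcs G"
  using pair_sym_arcs by (auto simp: symmetric_def dest: symD)

lemma (in pair_graph) finite_neighbours: "finite (parcs G `` {u})"
  using pair_finite_arcs by (rule finite_Image)

lemma (in pair_graph) card_neighbours_le_max_degree:
  "card (parcs G `` {u}) \<le> max_degree (with_proj G)"
proof (cases "u \<in> pverts G")
  case True
  then show ?thesis
    unfolding max_degree_def using pair_finite_verts by (auto simp: out_degree_with_proj intro!: Max_ge)
next
  case False
  then have "parcs G `` {u} = {}"
    using in_arcsD1 by auto
  then show ?thesis by simp
qed

lemma (in pair_graph) max_degree_pos:
  assumes "parcs G \<noteq> {}"
  shows "max_degree (with_proj G) > 0"
proof -
  obtain u v where "(u, v) \<in> parcs G"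
    using assms by auto
  then have "card (parcs G `` {u}) > 0"
    using finite_neighbours by (auto simp: card_gt_0_iff)
  then show ?thesis
    using card_neighbours_le_max_degree[of u] by simp
qed

text \<open>
  The pairs counted here are the inner vertices of the walks of length 3 from \<open>j\<close> to \<open>i\<close>.
\<close>

lemma (in pair_graph) complete_bipartite_if_max_walks:
  assumes conn: "Digraph_Component.connected (with_proj G)"
    and ji: "(j, i) \<in> parcs G"
    and walks: "card {(u, w) \<in> parcs G `` {j} \<times> parcs G `` {i}. (u, w) \<in> parcs G}
      = (max_degree (with_proj G))\<^sup>2"
  shows "complete_bipartite_digraph (max_degree (with_proj G)) (max_degree (with_proj G)) (with_proj G)"
proof -
  define d where "d = max_degree (with_proj G)"
  define U W where "U = parcs G `` {j}" and "W = parcs G `` {i}"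
  have fin: "finite U" "finite W"
    by (simp_all add: U_def W_def finite_neighbours)
  have le: "card (parcs G `` {x}) \<le> d" for x
    by (simp add: d_def card_neighbours_le_max_degree)
  have iU: "i \<in> U"
    using ji by (simp add: U_def)
  define P where "P = {(u, w) \<in> U \<times> W. (u, w) \<in> parcs G}"
  have P: "P \<subseteq> U \<times> W" "card P = d\<^sup>2"
    using walks by (auto simp: P_def U_def W_def d_def)
  have Ud: "card U \<le> d" and Wd: "card W \<le> d"
    using le by (simp_all add: U_def W_def)
  \<comment> \<open>The \<open>d^2\<close> elements of \<open>P\<close> lie in
    \<open>U \<times> W\<close> and both sides have at most \<open>d\<close> elements; as
    \<open>d > 0\<close>, a smaller side would make the product too small.\<close>
  have "\<not> (card U < d \<or> card W < d)"
  proof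
    assume "card U < d \<or> card W < d"
    moreover have "d > 0"
      using max_degree_pos ji by (auto simp: d_def)
    ultimately have "card U * card W < d\<^sup>2"
      by (auto simp: power2_eq_square intro: le_less_trans[OF mult_le_mono2[OF Wd]]
          le_less_trans[OF mult_le_mono1[OF Ud]])
    moreover have "d\<^sup>2 \<le> card U * card W"
      using card_mono[OF _ P(1)] fin P(2) by (simp add: card_cartesian_product)
    ultimately show False by simp
  qed
  then have cU: "card U = d" and cW: "card W = d"
    using Ud Wd by auto
  then have "P = U \<times> W"
    using P fin by (intro card_subset_eq) (auto simp: card_cartesian_product power2_eq_square)
  then have UW: "(u, w) \<in> parcs G" if "u \<in> U" "w \<in> W" for u w
    using that by (auto simp: P_def)
  \<comment> \<open>Every \<open>u\<close> in \<open>U\<close> is joined to all \<open>d\<close>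
    elements of \<open>W\<close>, and \<open>d\<close> is the maximum degree, so it has no further
    neighbour.\<close>
  have NU: "parcs G `` {u} = W" if "u \<in> U" for u
    using card_seteq[OF finite_neighbours, of W u] UW that le cW by auto
  have NW: "parcs G `` {w} = U" if "w \<in> W" for w
  proof -
    have "u \<in> parcs G `` {w}" if "u \<in> U" for u
      using UW[OF that \<open>w \<in> W\<close>] sym_parcs[of u w] by simp
    then show ?thesis
      using card_seteq[OF finite_neighbours, of U w] le cU by auto
  qed
  \<comment> \<open>By \<open>NU\<close> and \<open>NW\<close> no arc leaves
    \<open>U \<union> W\<close>.\<close>
  have "U \<union> W = pverts G"
  proof (rule connected_closed_eq[OF conn])
    show "U \<union> W \<subseteq> pverts G"
      using in_arcsD2 by (auto simp: U_def W_def)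
  qed (use iU NU NW in auto)
  \<comment> \<open>A common element would belong to its own neighbourhood \<open>W\<close>, which
    is a loop.\<close>
  moreover have "U \<inter> W = {}"
    using NU pair_no_loops by fastforce
  moreover have "parcs G = U \<times> W \<union> W \<times> U"
  proof -
    have "v \<in> parcs G `` {u} \<longleftrightarrow> (u, v) \<in> U \<times> W \<union> W \<times> U" for u v
    proof (cases "u \<in> U \<union> W")
      case True
      then show ?thesis
        using NU[of u] NW[of u] \<open>U \<inter> W = {}\<close> by blast
    next
      case False
      then show ?thesis
        using in_arcsD1 \<open>U \<union> W = pverts G\<close> by auto
    qed
    then show ?thesis by auto
  qed
  ultimately show ?thesis
    unfolding complete_bipartite_digraph_pair_def d_def[symmetric] using pair_finite_verts cU cW
    by blast
qed

text \<open>An isolated vertex is closed under arcs by itself, so it would be the whole graph and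
  there would be no arcs.\<close>

lemma (in pair_graph) ex_neighbour:
  assumes conn: "Digraph_Component.connected (with_proj G)"
    and ne: "parcs G \<noteq> {}" and i: "i \<in> pverts G"
  shows "\<exists>j. (j, i) \<in> parcs G"
proof (rule ccontr)
  assume none: "\<not> (\<exists>j. (j, i) \<in> parcs G)"
  have "{i} = pverts G"
    using none sym_parcs i by (intro connected_closed_eq[OF conn]) auto
  then show False
    using none ne in_arcsD1 in_arcsD2 by (metis ex_in_conv singletonD subrelI surj_pair)
qed

section \<open>Vertex energies\<close>

lemma sum_nth_distinct:
  assumes "distinct vs"
  shows "(\<Sum>l<length vs. f (vs ! l)) = sum f (set vs)"
  by (rule sum.reindex_bij_betw[OF bij_betw_nth[OF assms refl refl]])

lemma sum_of_bool_eq_card: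
  assumes "finite S"
  shows "(\<Sum>x\<in>S. of_bool (P x)) = (of_nat (card {x \<in> S. P x}) :: real)"
  using assms by (simp add: Int_def)

locale listed_graph = pair_graph G for G :: "'a pair_pre_digraph" +
  fixes vs :: "'a list"
  assumes distinct_vs: "distinct vs" and set_vs: "set vs = pverts G"
begin

abbreviation "A \<equiv> adj_mat G vs"
abbreviation "n \<equiv> length vs"
abbreviation "d \<equiv> max_degree (with_proj G)"

lemma adj_carrier: "A \<in> carrier_mat n n"
  by (simp add: adj_mat_def)

lemma adj_index: "i < n \<Longrightarrow> j < n \<Longrightarrow> A $$ (i, j) = of_bool ((vs ! i, vs ! j) \<in> parcs G)"
  by (simp add: adj_mat_def)

lemma transpose_adj: "transpose_mat A = A"
proof (rule eq_matI)
  fix i j assume "i < dim_row A" "j < dim_col A"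
  then show "transpose_mat A $$ (i, j) = A $$ (i, j)"
    using sym_parcs[of "vs ! i" "vs ! j"] by (simp add: adj_mat_def)
qed (simp_all add: adj_mat_def)

text \<open>Entries of products of 0-1 matrices are sums of indicators; the enumeration without
  repetition turns them into cardinalities of vertex sets.\<close>

lemma sum_of_bool_vs:
  "(\<Sum>l<n. of_bool (P (vs ! l))) = (of_nat (card {x \<in> pverts G. P x}) :: real)"
  using sum_nth_distinct[OF distinct_vs, of "\<lambda>x. of_bool (P x) :: real"]
    sum_of_bool_eq_card[OF pair_finite_verts, of P] by (simp add: set_vs)

lemma adj_row_sum:
  assumes "i < n"
  shows "(\<Sum>j<n. A $$ (i, j)) = out_degree (with_proj G) (vs ! i)"
proof -
  have "{x \<in> pverts G. (vs ! i, x) \<in> parcs G} = parcs G `` {vs ! i}"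
    using in_arcsD2 by auto
  then show ?thesis
    using assms sum_of_bool_vs[of "\<lambda>x. (vs ! i, x) \<in> parcs G"]
    by (simp add: adj_index out_degree_with_proj)
qed

lemma adj_square_index:
  assumes "i < n" "j < n"
  shows "(A * A) $$ (i, j) = card (parcs G `` {vs ! i} \<inter> parcs G `` {vs ! j})"
proof -
  have "{x \<in> pverts G. (vs ! i, x) \<in> parcs G \<and> (x, vs ! j) \<in> parcs G}
      = parcs G `` {vs ! i} \<inter> parcs G `` {vs ! j}"
    using in_arcsD2 sym_parcs by auto
  then show ?thesis
    using assms sum_of_bool_vs[of "\<lambda>x. (vs ! i, x) \<in> parcs G \<and> (x, vs ! j) \<in> parcs G"]
    by (simp add: index_mult_mat_sum[OF adj_carrier adj_carrier] adj_index of_bool_conj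
        del: index_mult_mat(1))
qed

lemma adj_square_diag:
  assumes "i < n"
  shows "(A * A) $$ (i, i) = out_degree (with_proj G) (vs ! i)"
  using adj_square_index[OF assms assms] by (simp add: out_degree_with_proj)

text \<open>The row sums of \<open>A\<close> are degrees, so Schur's test applies with the maximum
  degree.\<close>

lemma adj_norm_sq_le:
  assumes "x \<in> carrier_vec n"
  shows "(A *\<^sub>v x) \<bullet> (A *\<^sub>v x) \<le> (real d)\<^sup>2 * (x \<bullet> x)"
proof (rule sym_nonneg_mat_norm_sq_le[OF adj_carrier transpose_adj _ _ assms])
  fix i assume "i < n"
  then show "(\<Sum>j<n. A $$ (i, j)) \<le> real d"
    using card_neighbours_le_max_degree by (simp add: adj_row_sum out_degree_with_proj)
qed (simp add: adj_index)

text \<open>Counts the walks of length 3 from \<open>vs ! j\<close> to \<open>vs ! i\<close> by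
  their inner vertices \<open>u\<close> and \<open>w\<close>.\<close>

lemma adj_cube_index:
  assumes "i < n" "j < n"
  shows "(A *\<^sub>v (A *\<^sub>v (A *\<^sub>v unit_vec n i))) $ j
    = card {(u, w) \<in> parcs G `` {vs ! j} \<times> parcs G `` {vs ! i}. (u, w) \<in> parcs G}"
proof -
  define a :: "'a \<Rightarrow> 'a \<Rightarrow> real" where "a u w = of_bool ((u, w) \<in> parcs G)" for u w
  have entry: "A $$ (k, l) = a (vs ! k) (vs ! l)" if "k < n" "l < n" for k l
    using that by (simp add: adj_index a_def)
  have A: "A \<in> carrier_mat n n" by (rule adj_carrier)
  have "(A *\<^sub>v (A *\<^sub>v (A *\<^sub>v unit_vec n i))) $ j = (A * (A * A)) $$ (j, i)"
    using A assms index_mat_scalar_prod[of "A * (A * A)" n j i]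
    by (simp add: scalar_prod_left_unit[of _ n] assoc_mult_mat_vec[of _ n n _ n] del: index_mult_mat(1))
  also have "\<dots> = (\<Sum>k<n. \<Sum>l<n. a (vs ! j) (vs ! k) * (a (vs ! k) (vs ! l) * a (vs ! l) (vs ! i)))"
    using A assms
    by (simp add: index_mult_mat_sum[of _ n] entry sum_distrib_left del: index_mult_mat(1))
  also have "\<dots> = (\<Sum>u\<in>pverts G. \<Sum>w\<in>pverts G. a (vs ! j) u * (a u w * a w (vs ! i)))"
    by (simp only: set_vs[symmetric] flip: sum_nth_distinct[OF distinct_vs])
  also have "\<dots> = (\<Sum>(u, w)\<in>pverts G \<times> pverts G. a (vs ! j) u * (a u w * a w (vs ! i)))"
    by (rule sum.cartesian_product)
  also have "\<dots> = (\<Sum>p\<in>pverts G \<times> pverts G.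
      of_bool ((vs ! j, fst p) \<in> parcs G \<and> p \<in> parcs G \<and> (snd p, vs ! i) \<in> parcs G))"
    by (intro sum.cong refl) (auto simp: a_def)
  also have "\<dots> = card {p \<in> pverts G \<times> pverts G.
      (vs ! j, fst p) \<in> parcs G \<and> p \<in> parcs G \<and> (snd p, vs ! i) \<in> parcs G}"
    using pair_finite_verts by (intro sum_of_bool_eq_card finite_cartesian_product)
  also have "{p \<in> pverts G \<times> pverts G.
      (vs ! j, fst p) \<in> parcs G \<and> p \<in> parcs G \<and> (snd p, vs ! i) \<in> parcs G}
      = {(u, w) \<in> parcs G `` {vs ! j} \<times> parcs G `` {vs ! i}. (u, w) \<in> parcs G}"
    by (auto dest: in_arcsD1 in_arcsD2 simp: sym_parcs[of _ "vs ! i"])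
  finally show ?thesis .
qed

section \<open>The energy bound and its case of equality\<close>

lemma vertex_energy_ge:
  assumes ne: "parcs G \<noteq> {}" and i: "i < n"
  shows "vertex_energy G vs i \<ge> real (out_degree (with_proj G) (vs ! i)) / real d"
proof -
  have "real d > 0"
    using max_degree_pos[OF ne] by simp
  from mat_abs_diag_ge[OF adj_carrier transpose_adj this adj_norm_sq_le i]
  show ?thesis
    unfolding vertex_energy_def adj_square_diag[OF i] .
qed

text \<open>The identity \<open>A^3 e = d^2 A e\<close> is read in the coordinate of a neighbour of
  the vertex. There the entry of \<open>A e\<close> is 1, so the number of walks of length 3 is
  \<open>d^2\<close>.\<close>

lemma complete_bipartite_if_vertex_energy_eq:
  assumes conn: "Digraph_Component.connected (with_proj G)" and ne: "parcs G \<noteq> {}" and i: "i < n"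
    and eq: "vertex_energy G vs i = real (out_degree (with_proj G) (vs ! i)) / real d"
  shows "complete_bipartite_digraph d d (with_proj G)"
proof -
  have "vs ! i \<in> pverts G"
    using nth_mem[OF i] unfolding set_vs .
  then obtain v where v: "(v, vs ! i) \<in> parcs G"
    using ex_neighbour[OF conn ne] by auto
  then obtain j where j: "j < n" "vs ! j = v"
    using in_arcsD1 set_vs by (metis in_set_conv_nth)
  have "real d > 0"
    using max_degree_pos[OF ne] by simp
  note mat_abs_diag_eqD[OF adj_carrier transpose_adj this adj_norm_sq_le i]
  then have "A *\<^sub>v (A *\<^sub>v (A *\<^sub>v unit_vec n i)) = (real d)\<^sup>2 \<cdot>\<^sub>v (A *\<^sub>v unit_vec n i)"
    using eq unfolding vertex_energy_def adj_square_diag[OF i] by blast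
  moreover have "((real d)\<^sup>2 \<cdot>\<^sub>v (A *\<^sub>v unit_vec n i)) $ j = (real d)\<^sup>2 * A $$ (j, i)"
    using adj_carrier i j by simp
  ultimately have "real (card {(u, w) \<in> parcs G `` {v} \<times> parcs G `` {vs ! i}. (u, w) \<in> parcs G}) = (real d)\<^sup>2"
    using adj_cube_index[OF i j(1)] v i j by (simp add: adj_index)
  then show ?thesis
    by (intro complete_bipartite_if_max_walks[OF conn v]) (simp flip: of_nat_power)
qed

text \<open>
  For \<open>K\<^bsub>k,k\<^esub>\<close> the matrix \<open>|A|\<close> is the indicator of two vertices lying on the same side.
\<close>

lemma vertex_energy_complete_bipartite:
  assumes cb: "complete_bipartite_digraph k k (with_proj G)" and k: "k \<ge> 1" and i: "i < n"
  shows "vertex_energy G vs i = 1" and "out_degree (with_proj G) (vs ! i) = k" and "d = k"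
proof -
  obtain U V where UV: "pverts G = U \<union> V" "U \<inter> V = {}" and cards: "card U = k" "card V = k"
    and arcs: "parcs G = U \<times> V \<union> V \<times> U"
    using cb unfolding complete_bipartite_digraph_pair_def by blast
  have NU: "parcs G `` {u} = V" if "u \<in> U" for u
    using that UV arcs by auto
  have NV: "parcs G `` {u} = U" if "u \<in> V" for u
    using that UV arcs by auto
  have deg: "out_degree (with_proj G) u = k" if "u \<in> pverts G" for u
    using that UV NU NV cards by (auto simp: out_degree_with_proj)
  have inV: "vs ! j \<in> pverts G" if "j < n" for j
    using nth_mem[OF that] unfolding set_vs .
  show "out_degree (with_proj G) (vs ! i) = k"
    using deg inV i by auto
  have "out_degree (with_proj G) ` pverts G = {k}"
    using deg inV[OF i] by auto
  then show "d = k"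
    by (simp add: max_degree_def)
  define S :: "real mat" where "S = mat n n (\<lambda>(i, j). of_bool (vs ! i \<in> U \<longleftrightarrow> vs ! j \<in> U))"
  have S: "S \<in> carrier_mat n n"
    by (simp add: S_def)
  have S_index: "S $$ (i, j) = of_bool (vs ! i \<in> U \<longleftrightarrow> vs ! j \<in> U)" if "i < n" "j < n" for i j
    using that by (simp add: S_def)
  have AA: "A * A = real k \<cdot>\<^sub>m S"
  proof (rule eq_matI)
    fix i j assume "i < dim_row (real k \<cdot>\<^sub>m S)" "j < dim_col (real k \<cdot>\<^sub>m S)"
    then have ij: "i < n" "j < n"
      by (auto simp: S_def)
    have "card (parcs G `` {vs ! i} \<inter> parcs G `` {vs ! j}) = (if vs ! i \<in> U \<longleftrightarrow> vs ! j \<in> U then k else 0)"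
      using inV[OF ij(1)] inV[OF ij(2)] UV NU NV cards
      by (cases "vs ! i \<in> U"; cases "vs ! j \<in> U") (auto simp: Int_commute)
    then show "(A * A) $$ (i, j) = (real k \<cdot>\<^sub>m S) $$ (i, j)"
      using ij S by (simp add: adj_square_index S_index del: index_mult_mat(1))
  qed (use adj_carrier S in auto)
  \<comment> \<open>The summation vertex must lie on the side of both ends, which leaves
    \<open>k\<close> choices or none.\<close>
  have SS: "S * S = real k \<cdot>\<^sub>m S"
  proof (rule eq_matI)
    fix i j assume "i < dim_row (real k \<cdot>\<^sub>m S)" "j < dim_col (real k \<cdot>\<^sub>m S)"
    then have ij: "i < n" "j < n"
      by (auto simp: S_def)
    have "(S * S) $$ (i, j)
        = card {x \<in> pverts G. (vs ! i \<in> U \<longleftrightarrow> x \<in> U) \<and> (x \<in> U \<longleftrightarrow> vs ! j \<in> U)}"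
      using ij sum_of_bool_vs[of "\<lambda>x. (vs ! i \<in> U \<longleftrightarrow> x \<in> U) \<and> (x \<in> U \<longleftrightarrow> vs ! j \<in> U)"]
      by (simp add: index_mult_mat_sum[OF S S] S_index of_bool_conj del: index_mult_mat(1))
    moreover have "{x \<in> pverts G. (vs ! i \<in> U \<longleftrightarrow> x \<in> U) \<and> (x \<in> U \<longleftrightarrow> vs ! j \<in> U)}
        = (if vs ! i \<in> U \<longleftrightarrow> vs ! j \<in> U then if vs ! i \<in> U then U else V else {})"
      using UV by auto
    ultimately show "(S * S) $$ (i, j) = (real k \<cdot>\<^sub>m S) $$ (i, j)"
      using ij S cards by (simp add: S_index del: index_mult_mat(1))
  qed (use S in auto)
  \<comment> \<open>This scaled square is \<open>S\<close> by \<open>AA\<close>, so \<open>S\<close>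
    is semidefinite; as \<open>S * S = A * A\<close>, it is the required root.\<close>
  have "psd_mat ((1 / real k) \<cdot>\<^sub>m (A * A))"
    using psd_mat_mult_transpose[OF adj_carrier] adj_carrier transpose_adj
    by (intro psd_mat_smult[of _ n]) auto
  moreover have "(1 / real k) \<cdot>\<^sub>m (A * A) = S"
    unfolding AA using k by (intro eq_matI) auto
  ultimately have "psd_sqrt (A * A) = S"
    using S SS AA by (intro psd_sqrt_eqI[of _ n]) auto
  then show "vertex_energy G vs i = 1"
    using i by (simp add: vertex_energy_def mat_abs_def mat_adjoint_real transpose_adj S_index)
qed

end

theorem theorem3p3:
  fixes G :: "'a pair_pre_digraph" and vs :: "'a list" and i :: nat
  assumes "pair_graph G"
    and "Digraph_Component.connected (with_proj G)"
    and "parcs G \<noteq> {}"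
    and "distinct vs" and "set vs = pverts G"
    and "i < length vs"
  shows "vertex_energy G vs i
           \<ge> real (out_degree (with_proj G) (vs ! i)) / real (max_degree (with_proj G))
       \<and> (vertex_energy G vs i
            = real (out_degree (with_proj G) (vs ! i)) / real (max_degree (with_proj G))
          \<longleftrightarrow> (\<exists>d\<ge>1. digraph_iso (with_proj G) (with_proj (complete_bipartite d d))))"
proof -
  interpret pair_graph G by (rule assms(1))
  interpret listed_graph G vs
    using assms(4,5) by unfold_locales
  have iso: "digraph_iso (with_proj G) (with_proj (complete_bipartite k k))
      \<longleftrightarrow> complete_bipartite_digraph k k (with_proj G)" for k
    by (rule digraph_iso_complete_bipartite_iff) unfold_locales
  \<comment> \<open>The maximum degree is the witness for \<open>d\<close> when equality
    holds.\<close>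
  have "max_degree (with_proj G) \<ge> 1"
    using max_degree_pos[OF assms(3)] by simp
  moreover have "vertex_energy G vs i
      = real (out_degree (with_proj G) (vs ! i)) / real (max_degree (with_proj G))"
    if "complete_bipartite_digraph k k (with_proj G)" "k \<ge> 1" for k
    \<comment> \<open>Rewriting the energy, the degree and the maximum degree reduces the claim to
      \<open>1 = k / k\<close>.\<close>
    using that(2) unfolding vertex_energy_complete_bipartite[OF that assms(6)] by simp
  ultimately show ?thesis
    unfolding iso
    using vertex_energy_ge[OF assms(3,6)]
      complete_bipartite_if_vertex_energy_eq[OF assms(2,3,6)] by blast
qed

end
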